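(* Let $(\mathcal{X},d)$ be a proper and unbounded metric space. Let $N\geq 2$, $\boldsymbol{\nu}=(\nu_1,\dots,\nu_N)\in \mathcal{P}_1(\mathcal{X})^N$ and $\boldsymbol{\lambda}=(\lambda_1,\dots,\lambda_N)\in\Delta_N$. Then the break-down point (in the metric space $(\mathcal{P}_1(\mathcal{X}),W_1)$, for the set-valued map $\boldsymbol{\mu}\mapsto \mathrm{Med}_{\boldsymbol{\lambda}}(\boldsymbol{\mu})$ at $\boldsymbol{\nu}$) is $$b(\mathrm{Med}_{\boldsymbol{\lambda}}(\boldsymbol{\nu}))=\min\Big\{\sum_{j\in J}\lambda_j \;:\; J\subset\{1,\dots,N\},\ \sum_{j\in J}\lambda_j\geq \tfrac12\Big\}.$$
   Context: A metric space is proper if its closed balls are compact. $\Delta_N=\{(\lambda_1,\dots,\lambda_N)\in\mathbb{R}_+^N:\sum_i\lambda_i=1\}$. $\mathcal{P}_1(\mathcal{X})$ is the set of Borel probability measures $\mu$ on $\mathcal{X}$ with $\int d(x_0,x)\,d\mu(x)<\infty$ for some $x_0$, equipped with the 1-Wasserstein distance $W_1(\mu,\nu)=\inf_{\gamma\in\Pi(\mu,\nu)}\int d(x,y)\,d\gamma(x,y)$, where $\Pi(\mu,\nu)$ is the set of couplings. For $\boldsymbol{\mu}=(\mu_1,\dots,\mu_N)\in\mathcal{P}_1(\mathcal{X})^N$, $\mathrm{Med}_{\boldsymbol{\lambda}}(\boldsymbol{\mu})$ is the (nonempty) set of minimizers over $\mu\in\mathcal{P}_1(\mathcal{X})$ of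 $\sum_{i=1}^N\lambda_iW_1(\mu_i,\mu)$ (Wasserstein medians). Break-down point: for a metric space $(\mathcal{Y},\delta)$, weights $\boldsymbol{\lambda}\in\Delta_N$, a set-valued map $t_{\boldsymbol{\lambda}}:\mathcal{Y}^N\to 2^{\mathcal{Y}}$ with nonempty values and $\mathbf{x}=(x_1,\dots,x_N)\in\mathcal{Y}^N$, $$b(t_{\boldsymbol{\lambda}}(\mathbf{x}))=\min\Big\{\sum_{i\in I}\lambda_i: I\subset\{1,\dots,N\},\ \sup_{\mathbf{y}^I\in\mathcal{Y}^N,\ \mathbf{y}^I_j=x_j\ \forall j\notin I}\{\delta(y,x): y\in t_{\boldsymbol{\lambda}}(\mathbf{y}^I),\ x\in t_{\boldsymbol{\lambda}}(\mathbf{x})\}=+\infty\Big\}.$$ *)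

theory Defs
  imports "HOL-Probability.Probability"
begin

definition P1 :: "('a::metric_space) measure set" where
  "P1 = {\<mu>. prob_space \<mu> \<and> sets \<mu> = sets borel \<and>
            (\<exists>x0. (\<integral>\<^sup>+ x. ennreal (dist x0 x) \<partial>\<mu>) < \<infinity>)}"

definition couplings :: "('a::metric_space) measure \<Rightarrow> 'a measure \<Rightarrow> ('a \<times> 'a) measure set" where
  "couplings \<mu> \<nu> = {\<gamma>. sets \<gamma> = sets (borel \<Otimes>\<^sub>M borel) \<and>
                        distr \<gamma> borel fst = \<mu> \<and> distr \<gamma> borel snd = \<nu>}"

text \<open>1-Wasserstein distance (finite on P1).\<close>
definition W1 :: "('a::metric_space) measure \<Rightarrow> 'a measure \<Rightarrow> real" where
  "W1 \<mu> \<nu> = enn2real (\<Sqinter>\<gamma>\<in>couplings \<mu> \<nu>. \<integral>\<^sup>+ p. ennreal (dist (fst p) (snd p)) \<partial>\<gamma>)"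

definition Med :: "nat \<Rightarrow> (nat \<Rightarrow> real) \<Rightarrow> (nat \<Rightarrow> ('a::metric_space) measure) \<Rightarrow> 'a measure set" where
  "Med N lam \<mu> = {m \<in> P1. \<forall>m'\<in>P1.
      (\<Sum>i<N. lam i * W1 (\<mu> i) m) \<le> (\<Sum>i<N. lam i * W1 (\<mu> i) m')}"

definition breakdown :: "'b set \<Rightarrow> ('b \<Rightarrow> 'b \<Rightarrow> real) \<Rightarrow> nat \<Rightarrow> (nat \<Rightarrow> real)
     \<Rightarrow> ((nat \<Rightarrow> 'b) \<Rightarrow> 'b set) \<Rightarrow> (nat \<Rightarrow> 'b) \<Rightarrow> real" where
  "breakdown Y \<delta> N lam t x = Min {sum lam I | I. I \<subseteq> {..<N} \<and>
      \<not> bdd_above {\<delta> y z | y z. \<exists>yI. (\<forall>j\<in>I. yI j \<in> Y) \<and> (\<forall>j. j \<notin> I \<longrightarrow> yI j = x j)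
                                    \<and> y \<in> t yI \<and> z \<in> t x}}"

end

theory Submission
  imports Defs
begin

text \<open>By the triangle inequality for \<open>W\<^sub>1\<close>, corrupting a set of weight at least \<open>1/2\<close> by a common
  measure \<open>m\<close> makes \<open>m\<close> a median, and Dirac masses drift to infinity; corrupting weight \<open>s < 1/2\<close>
  moves medians by at most \<open>2 / (1 - 2 s)\<close> times the uncorrupted minimal value. What remains is the
  triangle inequality and the existence of medians. For the former, disintegration is avoided by gluing
  couplings along a countable partition into sets of small diameter, which costs an arbitrarily small
  error. The latter is the direct method: narrow compactness is reduced to Helly's theorem on the real
  line by coding a proper space into the reals.\<close>

subsection \<open>Proper metric spaces and couplings\<close>

text \<open>Properness is a hypothesis on a bare \<open>metric_space\<close>, not a type class, so
  separability enters through an explicit dense sequence \<open>q\<close>: it identifies the Borel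
  sets of a product, cuts the space into small cells and supplies the balls of the code. Narrow
  compactness is needed twice, for a minimizing sequence of measures and for near-optimal couplings,
  which live on the product; hence it is proved for every proper metric space. The threshold 1/2
  comes from a balance: if a competitor lies at distance D, corrupted indices of total weight s can
  favour it by at most s D, while the clean ones penalize it by (1 - s) D up to a term bounded by
  twice the uncorrupted objective; the sign of 1 - 2 s decides. Existence of a median of \<nu>
  matters beyond well-posedness: if \<open>Med\<close> were empty at \<nu>, the set of distances in
  \<open>breakdown\<close> would be empty, hence bounded, for every index set.\<close>

lemma proper_dense_sequence:
  assumes proper: "\<forall>(x::'a::metric_space) r. compact (cball x r)"
  obtains q :: "nat \<Rightarrow> 'a::metric_space" where "\<And>x e. e > 0 \<Longrightarrow> \<exists>n. dist x (q n) < e"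
proof -
  define x0 where "x0 = (undefined :: 'a)"
  have "\<exists>k. finite k \<and> cball x0 (real n) \<subseteq> (\<Union>x\<in>k. ball x (inverse (real (Suc j))))" for n j
    using proper[rule_format, of x0 "real n"] unfolding compact_eq_totally_bounded by simp
  then obtain k where k: "\<And>n j. finite (k n j)"
      "\<And>n j. cball x0 (real n) \<subseteq> (\<Union>x\<in>k n j. ball x (inverse (real (Suc j))))"
    by metis
  define D where "D = insert x0 (\<Union>n. \<Union>j. k n j)"
  have D: "countable D" "D \<noteq> {}"
    unfolding D_def using countable_finite[OF k(1)] by (auto intro: countable_UN)
  have near: "\<exists>d\<in>D. dist x d < e" if e: "e > 0" for x e
  proof -
    obtain n where n: "dist x0 x \<le> real n" using real_arch_simple by blast
    obtain j where j: "inverse (real (Suc j)) < e" using reals_Archimedean[OF e] by blast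
    have "x \<in> cball x0 (real n)" using n by simp
    then obtain d where "d \<in> k n j" "dist d x < inverse (real (Suc j))"
      using k(2)[of n j] by auto
    then show ?thesis using j unfolding D_def by (intro bexI[of _ d]) (auto simp: dist_commute)
  qed
  show ?thesis
  proof (rule that[of "from_nat_into D"])
    fix x :: 'a and e :: real assume "e > 0"
    then obtain d where "d \<in> D" "dist x d < e" using near by blast
    then show "\<exists>n. dist x (from_nat_into D n) < e"
      using from_nat_into_surj[OF D(1)] by blast
  qed
qed

text \<open>Makes the compactness theorem for measures applicable to couplings, whose base space is
  the product.\<close>

lemma compact_cball_prod:
  assumes "\<forall>(x::'a::metric_space) r. compact (cball x r)"
    and "\<forall>(x::'b::metric_space) r. compact (cball x r)"
  shows "\<forall>(x::'a \<times> 'b) r. compact (cball x r)"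
proof (intro allI)
  fix x :: "'a \<times> 'b" and r
  have "cball x r \<subseteq> cball (fst x) r \<times> cball (snd x) r"
  proof
    fix y assume "y \<in> cball x r"
    then show "y \<in> cball (fst x) r \<times> cball (snd x) r"
      using dist_fst_le[of x y] dist_snd_le[of x y] by (auto simp: mem_Times_iff)
  qed
  moreover have "compact (cball (fst x) r \<times> cball (snd x) r)"
    using assms by (intro compact_Times) auto
  ultimately show "compact (cball x r)"
    using compact_Int_closed[of "cball (fst x) r \<times> cball (snd x) r" "cball x r"]
    by (simp add: Int_absorb1)
qed

text \<open>Without separability the product \<sigma>-algebra can be smaller than the Borel one.
  Here each open set is a union of rectangles of balls with centres in the two dense sequences and
  radii 1/(k+1), a countable family.\<close>

lemma sets_borel_pair_dense:
  fixes q :: "nat \<Rightarrow> 'a::metric_space" and r :: "nat \<Rightarrow> 'b::metric_space"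
  assumes q: "\<And>x e. e > 0 \<Longrightarrow> \<exists>n. dist x (q n) < e"
    and r: "\<And>x e. e > 0 \<Longrightarrow> \<exists>n. dist x (r n) < e"
  shows "sets (borel \<Otimes>\<^sub>M borel) = sets (borel :: ('a \<times> 'b) measure)"
proof
  have "fst \<in> measurable (borel :: ('a \<times> 'b) measure) borel"
    "snd \<in> measurable (borel :: ('a \<times> 'b) measure) borel"
    by (auto intro!: borel_measurable_continuous_onI continuous_intros)
  then have "(\<lambda>p. (fst p, snd p)) \<in> measurable (borel :: ('a \<times> 'b) measure) (borel \<Otimes>\<^sub>M borel)"
    by (rule measurable_Pair)
  then show "sets (borel \<Otimes>\<^sub>M borel) \<subseteq> sets (borel :: ('a \<times> 'b) measure)"
    by (auto dest: measurable_sets)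
next
  have op: "S \<in> sets (borel \<Otimes>\<^sub>M borel)" if S: "open S" for S :: "('a \<times> 'b) set"
  proof -
    define U where "U i j k = ball (q i) (inverse (real (Suc k))) \<times> ball (r j) (inverse (real (Suc k)))"
      for i j k
    have "S \<subseteq> (\<Union>i. \<Union>j. \<Union>k\<in>{k. U i j k \<subseteq> S}. U i j k)"
    proof
      fix p assume "p \<in> S"
      obtain x y where p: "p = (x, y)" by (cases p)
      obtain A B where AB: "open A" "open B" "p \<in> A \<times> B" "A \<times> B \<subseteq> S"
        using open_prod_elim[OF S \<open>p \<in> S\<close>] .
      have xy: "x \<in> A" "y \<in> B" using AB p by auto
      obtain e1 where e1: "e1 > 0" "ball x e1 \<subseteq> A" using AB(1) xy(1) open_contains_ball by blast
      obtain e2 where e2: "e2 > 0" "ball y e2 \<subseteq> B" using AB(2) xy(2) open_contains_ball by blast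
      \<comment> \<open>The half leaves room for recentring: a ball of radius \<open>d\<close> whose
        centre is within \<open>d\<close> of \<open>x\<close> lies in the ball of radius
        \<open>2 * d\<close> about \<open>x\<close>.\<close>
      obtain k where k: "inverse (real (Suc k)) < min e1 e2 / 2"
        using reals_Archimedean[of "min e1 e2 / 2"] e1 e2 by auto
      define d where "d = inverse (real (Suc k))"
      have d: "d > 0" unfolding d_def by simp
      obtain i where i: "dist x (q i) < d" using q[OF d] by blast
      obtain j where j: "dist y (r j) < d" using r[OF d] by blast
      have b1: "ball (q i) d \<subseteq> ball x e1"
      proof
        fix u assume "u \<in> ball (q i) d"
        then have "dist x u < 2 * d" using i dist_triangle[of x u "q i"] by simp
        then show "u \<in> ball x e1" using k unfolding d_def by simp
      qed
      have b2: "ball (r j) d \<subseteq> ball y e2"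
      proof
        fix u assume "u \<in> ball (r j) d"
        then have "dist y u < 2 * d" using j dist_triangle[of y u "r j"] by simp
        then show "u \<in> ball y e2" using k unfolding d_def by simp
      qed
      have "U i j k \<subseteq> S"
        using b1 b2 e1(2) e2(2) AB(4) unfolding U_def d_def[symmetric] by blast
      moreover have "p \<in> U i j k"
        unfolding U_def d_def[symmetric] p using i j by (simp add: dist_commute)
      ultimately show "p \<in> (\<Union>i. \<Union>j. \<Union>k\<in>{k. U i j k \<subseteq> S}. U i j k)" by blast
    qed
    then have "S = (\<Union>i. \<Union>j. \<Union>k\<in>{k. U i j k \<subseteq> S}. U i j k)" by blast
    also have "\<dots> \<in> sets (borel \<Otimes>\<^sub>M borel)"
      unfolding U_def by (intro sets.countable_UN' sets.countable_UN pair_measureI) auto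
    finally show ?thesis .
  qed
  have "sigma_sets UNIV {S :: ('a \<times> 'b) set. open S} \<subseteq> sets (borel \<Otimes>\<^sub>M borel)"
    using sets.sigma_sets_subset[of "{S. open S}" "borel \<Otimes>\<^sub>M borel :: ('a \<times> 'b) measure"] op
    by (auto simp: space_pair_measure)
  then show "sets (borel :: ('a \<times> 'b) measure) \<subseteq> sets (borel \<Otimes>\<^sub>M borel)"
    unfolding borel_def by auto
qed

lemma measurable_dist_dense:
  fixes q :: "nat \<Rightarrow> 'a::metric_space"
  assumes q: "\<And>x e. e > 0 \<Longrightarrow> \<exists>n. dist x (q n) < e"
  shows "(\<lambda>p. dist (fst p) (snd p)) \<in> borel_measurable (borel \<Otimes>\<^sub>M (borel :: 'a measure))"
proof -
  have "(\<lambda>p. dist (fst p) (snd p)) \<in> borel_measurable (borel :: ('a \<times> 'a) measure)"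
    by (intro borel_measurable_continuous_onI continuous_intros)
  then show ?thesis
    using measurable_cong_sets[OF sets_borel_pair_dense[OF q q] refl] by blast
qed

text \<open>Kept in \<open>ennreal\<close>: an infinite cost is \<open>top\<close> here but becomes
  0 under \<open>enn2real\<close>. The triangle inequality is therefore proved at this level,
  without moment assumptions, and transferred to \<open>W1\<close> on \<open>P1\<close>.\<close>

definition transport_cost :: "('a::metric_space) measure \<Rightarrow> 'a measure \<Rightarrow> ennreal" where
  "transport_cost \<mu> \<nu> = (\<Sqinter>\<gamma>\<in>couplings \<mu> \<nu>. \<integral>\<^sup>+ p. ennreal (dist (fst p) (snd p)) \<partial>\<gamma>)"

lemma W1_eq: "W1 \<mu> \<nu> = enn2real (transport_cost \<mu> \<nu>)"
  by (simp add: W1_def transport_cost_def)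

lemma couplings_nn_integral:
  assumes g: "\<gamma> \<in> couplings \<mu> \<nu>" and [measurable]: "f \<in> borel_measurable borel"
  shows "(\<integral>\<^sup>+ p. f (fst p) \<partial>\<gamma>) = (\<integral>\<^sup>+ x. f x \<partial>\<mu>)" "(\<integral>\<^sup>+ p. f (snd p) \<partial>\<gamma>) = (\<integral>\<^sup>+ x. f x \<partial>\<nu>)"
proof -
  have [measurable_cong]: "sets \<gamma> = sets (borel \<Otimes>\<^sub>M borel)"
    and m: "distr \<gamma> borel fst = \<mu>" "distr \<gamma> borel snd = \<nu>"
    using g by (auto simp: couplings_def)
  show "(\<integral>\<^sup>+ p. f (fst p) \<partial>\<gamma>) = (\<integral>\<^sup>+ x. f x \<partial>\<mu>)" "(\<integral>\<^sup>+ p. f (snd p) \<partial>\<gamma>) = (\<integral>\<^sup>+ x. f x \<partial>\<nu>)"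
    unfolding m[symmetric] by (simp_all add: nn_integral_distr)
qed

lemma prob_space_coupling:
  assumes g: "\<gamma> \<in> couplings \<mu> \<nu>" and "prob_space \<mu>"
  shows "prob_space \<gamma>"
proof -
  have [measurable_cong]: "sets \<gamma> = sets (borel \<Otimes>\<^sub>M borel)"
    and m: "distr \<gamma> borel fst = \<mu>"
    using g by (auto simp: couplings_def)
  have "fst \<in> measurable \<gamma> borel" by measurable
  from prob_space_distrD[OF this] show ?thesis using assms(2) m by simp
qed

lemma couplings_swap:
  assumes g: "\<gamma> \<in> couplings \<mu> \<nu>"
  shows "distr \<gamma> (borel \<Otimes>\<^sub>M borel) (\<lambda>p. (snd p, fst p)) \<in> couplings \<nu> \<mu>"
proof -
  have [measurable_cong]: "sets \<gamma> = sets (borel \<Otimes>\<^sub>M borel)"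
    and m: "distr \<gamma> borel fst = \<mu>" "distr \<gamma> borel snd = \<nu>"
    using g by (auto simp: couplings_def)
  show ?thesis
    unfolding couplings_def m[symmetric] by (simp add: distr_distr comp_def)
qed

lemma couplings_pair:
  assumes "prob_space \<mu>" "prob_space \<nu>" and s: "sets \<mu> = sets borel" "sets \<nu> = sets borel"
  shows "\<mu> \<Otimes>\<^sub>M \<nu> \<in> couplings \<mu> \<nu>"
proof -
  interpret a: prob_space \<mu> by fact
  interpret b: prob_space \<nu> by fact
  have sp: "space \<mu> = UNIV" "space \<nu> = UNIV"
    using sets_eq_imp_space_eq[OF s(1)] sets_eq_imp_space_eq[OF s(2)] by simp_all
  have [measurable_cong]: "sets (\<mu> \<Otimes>\<^sub>M \<nu>) = sets (borel \<Otimes>\<^sub>M borel)"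
    using s by (rule sets_pair_measure_cong)
  have "distr (\<mu> \<Otimes>\<^sub>M \<nu>) borel fst = \<mu>"
  proof (rule measure_eqI)
    fix A :: "'a set" assume "A \<in> sets (distr (\<mu> \<Otimes>\<^sub>M \<nu>) borel fst)"
    then have [measurable]: "A \<in> sets borel" by simp
    have "emeasure (distr (\<mu> \<Otimes>\<^sub>M \<nu>) borel fst) A = emeasure (\<mu> \<Otimes>\<^sub>M \<nu>) (A \<times> space \<nu>)"
      by (subst emeasure_distr) (auto simp: space_pair_measure sp intro!: arg_cong[where f="emeasure _"])
    also have "\<dots> = emeasure \<mu> A"
      using s b.emeasure_pair_measure_Times[of A \<mu> "space \<nu>"] b.emeasure_space_1 by (simp add: sp)
    finally show "emeasure (distr (\<mu> \<Otimes>\<^sub>M \<nu>) borel fst) A = emeasure \<mu> A" .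
  qed (simp add: s)
  moreover have "distr (\<mu> \<Otimes>\<^sub>M \<nu>) borel snd = \<nu>"
  proof (rule measure_eqI)
    fix A :: "'a set" assume "A \<in> sets (distr (\<mu> \<Otimes>\<^sub>M \<nu>) borel snd)"
    then have [measurable]: "A \<in> sets borel" by simp
    have "emeasure (distr (\<mu> \<Otimes>\<^sub>M \<nu>) borel snd) A = emeasure (\<mu> \<Otimes>\<^sub>M \<nu>) (space \<mu> \<times> A)"
      by (subst emeasure_distr) (auto simp: space_pair_measure sp intro!: arg_cong[where f="emeasure _"])
    also have "\<dots> = emeasure \<nu> A"
      using s b.emeasure_pair_measure_Times[of "space \<mu>" \<mu> A] a.emeasure_space_1 by (simp add: sp)
    finally show "emeasure (distr (\<mu> \<Otimes>\<^sub>M \<nu>) borel snd) A = emeasure \<nu> A" .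
  qed (simp add: s)
  ultimately show ?thesis
    unfolding couplings_def using sets_pair_measure_cong[OF s] by simp
qed

subsection \<open>The triangle inequality\<close>

lemma transport_cost_commute:
  fixes \<mu> \<nu> :: "'a::metric_space measure"
    and q :: "nat \<Rightarrow> 'a"
  assumes q: "\<And>x e. e > 0 \<Longrightarrow> \<exists>n. dist x (q n) < e"
  shows "transport_cost \<mu> \<nu> = transport_cost \<nu> \<mu>"
proof -
  have "transport_cost \<nu> \<mu> \<le> transport_cost \<mu> \<nu>" for \<mu> \<nu> :: "'a measure"
    unfolding transport_cost_def
  proof (rule INF_mono)
    fix \<gamma> assume g: "\<gamma> \<in> couplings \<mu> \<nu>"
    then have [measurable_cong]: "sets \<gamma> = sets (borel \<Otimes>\<^sub>M borel)" by (simp add: couplings_def)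
    note [measurable] = measurable_dist_dense[OF q]
    have "(\<integral>\<^sup>+ p. ennreal (dist (fst p) (snd p)) \<partial>distr \<gamma> (borel \<Otimes>\<^sub>M borel) (\<lambda>p. (snd p, fst p)))
        = (\<integral>\<^sup>+ p. ennreal (dist (fst p) (snd p)) \<partial>\<gamma>)"
      by (subst nn_integral_distr) (simp_all add: dist_commute)
    then show "\<exists>\<gamma>'\<in>couplings \<nu> \<mu>. (\<integral>\<^sup>+ p. ennreal (dist (fst p) (snd p)) \<partial>\<gamma>')
        \<le> (\<integral>\<^sup>+ p. ennreal (dist (fst p) (snd p)) \<partial>\<gamma>)"
      by (intro bexI[OF _ couplings_swap[OF g]]) simp
  qed
  then show ?thesis by (simp add: antisym)
qed

text \<open>Conditioning on the middle point is replaced by conditioning on its cell: pairs of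
  \<open>\<gamma>1\<close> and \<open>\<gamma>2\<close> whose middle points share a cell are joined
  independently, with weight \<open>h\<close>, the reciprocal of the mass of the cell. Since both
  middle marginals are \<open>m\<close>, the outer marginals come out exactly; only the cost
  suffers, by at most the cell diameter.\<close>

lemma approximate_gluing:
  fixes \<mu> m \<nu> :: "'a::metric_space measure"
    and q :: "nat \<Rightarrow> 'a"
  assumes q: "\<And>x e. e > 0 \<Longrightarrow> \<exists>n. dist x (q n) < e"
    and m: "prob_space m"
    and g1: "\<gamma>1 \<in> couplings \<mu> m" and g2: "\<gamma>2 \<in> couplings m \<nu>"
    and e: "e > 0"
  obtains \<gamma> where "\<gamma> \<in> couplings \<mu> \<nu>"
    "(\<integral>\<^sup>+ p. ennreal (dist (fst p) (snd p)) \<partial>\<gamma>)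
      \<le> (\<integral>\<^sup>+ p. ennreal (dist (fst p) (snd p)) \<partial>\<gamma>1) + (\<integral>\<^sup>+ p. ennreal (dist (fst p) (snd p)) \<partial>\<gamma>2) + ennreal e"
proof -
  interpret m: prob_space m by fact
  have [measurable_cong]: "sets \<gamma>1 = sets (borel \<Otimes>\<^sub>M borel)"
    and m1: "distr \<gamma>1 borel fst = \<mu>" "distr \<gamma>1 borel snd = m"
    using g1 by (auto simp: couplings_def)
  have [measurable_cong]: "sets \<gamma>2 = sets (borel \<Otimes>\<^sub>M borel)"
    and m2: "distr \<gamma>2 borel fst = m" "distr \<gamma>2 borel snd = \<nu>"
    using g2 by (auto simp: couplings_def)
  have [measurable_cong]: "sets m = sets borel" unfolding m1(2)[symmetric] by simp
  interpret g1: prob_space \<gamma>1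
    by (rule prob_space_distrD[of snd _ borel]) (simp_all add: m1 m)
  interpret g2: prob_space \<gamma>2 by (rule prob_space_coupling[OF g2 m])
  interpret pair_prob_space \<gamma>1 \<gamma>2 ..
  note [measurable] = measurable_dist_dense[OF q]
  \<comment> \<open>Taking the least index turns the cover by balls of radius \<open>e / 2\<close>
    into a countable measurable partition with cells of diameter at most \<open>e\<close>.\<close>
  define c where "c x = (LEAST n. dist x (q n) < e / 2)" for x
  have c_near: "dist x (q (c x)) < e / 2" for x
    unfolding c_def by (rule LeastI_ex) (use q[of "e/2" x] e in auto)
  have [measurable]: "c \<in> measurable borel (count_space UNIV)"
  proof -
    have "open {x. dist x (q n) < e / 2}" for n
      by (intro open_Collect_less continuous_intros)
    then have [measurable]: "Measurable.pred borel (\<lambda>x. dist x (q n) < e / 2)" for n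
      by (simp add: pred_def)
    then show ?thesis unfolding c_def by measurable
  qed
  have [measurable]: "c -` {j} \<in> sets borel" for j
    using measurable_sets[OF \<open>c \<in> measurable borel (count_space UNIV)\<close>, of "{j}"] by simp
  define w where "w j = emeasure m (c -` {j})" for j
  have w_fin: "w j \<noteq> \<infinity>" for j unfolding w_def by simp
  define h where "h = (\<lambda>z :: ('a \<times> 'a) \<times> ('a \<times> 'a).
    if c (snd (fst z)) = c (fst (snd z)) then inverse (w (c (snd (fst z)))) else 0)"
  \<comment> \<open>\<open>inverse 0 = \<infinity>\<close> in \<open>ennreal\<close>, but this value is taken on null sets only.\<close>
  have [measurable]: "h \<in> borel_measurable (\<gamma>1 \<Otimes>\<^sub>M \<gamma>2)"
  proof -
    have [measurable]: "(\<lambda>x. inverse (w (c x))) \<in> borel_measurable borel"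
      by (rule measurable_compose[OF \<open>c \<in> measurable borel (count_space UNIV)\<close>]) simp
    have [measurable]: "(\<lambda>x. real (c x)) \<in> borel_measurable borel" by measurable
    have "h = (\<lambda>z. if real (c (snd (fst z))) = real (c (fst (snd z))) then inverse (w (c (snd (fst z)))) else 0)"
      unfolding h_def by simp
    also have "\<dots> \<in> borel_measurable (\<gamma>1 \<Otimes>\<^sub>M \<gamma>2)" by measurable
    finally show ?thesis .
  qed
  \<comment> \<open>There are countably many cells, so those of mass zero form a null set; off it
    \<open>inverse (w j)\<close> is a genuine reciprocal.\<close>
  have AE_w: "AE x in m. w (c x) \<noteq> 0"
  proof -
    have "AE x in m. \<forall>j. w j = 0 \<longrightarrow> c x \<noteq> j"
    proof (subst AE_all_countable, rule allI)
      fix j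
      show "AE x in m. w j = 0 \<longrightarrow> c x \<noteq> j"
      proof (cases "w j = 0")
        case True
        have "c -` {j} \<in> null_sets m"
          using True unfolding w_def by (intro null_setsI) simp_all
        from AE_not_in[OF this] show ?thesis by eventually_elim auto
      qed simp
    qed
    then show ?thesis by eventually_elim auto
  qed
  have AE1: "AE p in \<gamma>1. w (c (snd p)) \<noteq> 0"
    using AE_w unfolding m1(2)[symmetric] by (subst (asm) AE_distr_iff) (auto simp: m1)
  have AE2: "AE p in \<gamma>2. w (c (fst p)) \<noteq> 0"
    using AE_w unfolding m2(1)[symmetric] by (subst (asm) AE_distr_iff) (auto simp: m2)
  have sec1: "(\<integral>\<^sup>+ p'. h (p, p') \<partial>\<gamma>2) = 1" if "w (c (snd p)) \<noteq> 0" for p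
  proof -
    have "(\<integral>\<^sup>+ p'. h (p, p') \<partial>\<gamma>2)
        = (\<integral>\<^sup>+ p'. inverse (w (c (snd p))) * indicator (c -` {c (snd p)}) (fst p') \<partial>\<gamma>2)"
      by (intro nn_integral_cong) (auto simp: h_def)
    also have "\<dots> = (\<integral>\<^sup>+ x. inverse (w (c (snd p))) * indicator (c -` {c (snd p)}) x \<partial>m)"
      by (rule couplings_nn_integral(1)[OF g2]) simp
    also have "\<dots> = inverse (w (c (snd p))) * w (c (snd p))"
      unfolding w_def by (subst nn_integral_cmult_indicator) auto
    also have "\<dots> = 1" using that w_fin ennreal_divide_self by (simp add: divide_ennreal_def mult.commute less_top)
    finally show ?thesis .
  qed
  have sec2: "(\<integral>\<^sup>+ p. h (p, p') \<partial>\<gamma>1) = 1" if "w (c (fst p')) \<noteq> 0" for p'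
  proof -
    have "(\<integral>\<^sup>+ p. h (p, p') \<partial>\<gamma>1)
        = (\<integral>\<^sup>+ p. inverse (w (c (fst p'))) * indicator (c -` {c (fst p')}) (snd p) \<partial>\<gamma>1)"
      by (intro nn_integral_cong) (auto simp: h_def)
    also have "\<dots> = (\<integral>\<^sup>+ x. inverse (w (c (fst p'))) * indicator (c -` {c (fst p')}) x \<partial>m)"
      by (rule couplings_nn_integral(2)[OF g1]) simp
    also have "\<dots> = inverse (w (c (fst p'))) * w (c (fst p'))"
      unfolding w_def by (subst nn_integral_cmult_indicator) auto
    also have "\<dots> = 1" using that w_fin ennreal_divide_self by (simp add: divide_ennreal_def mult.commute less_top)
    finally show ?thesis .
  qed
  \<comment> \<open>The sections of \<open>h\<close> integrate to 1 almost everywhere, so by Tonelli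
    the reweighted product still has marginals \<open>\<gamma>1\<close> and, by \<open>int2\<close>,
    \<open>\<gamma>2\<close>.\<close>
  have int1: "(\<integral>\<^sup>+ z. h z * f (fst z) \<partial>(\<gamma>1 \<Otimes>\<^sub>M \<gamma>2)) = (\<integral>\<^sup>+ p. f p \<partial>\<gamma>1)"
    if [measurable]: "f \<in> borel_measurable (borel \<Otimes>\<^sub>M borel)" for f
  proof -
    have "(\<integral>\<^sup>+ z. h z * f (fst z) \<partial>(\<gamma>1 \<Otimes>\<^sub>M \<gamma>2)) = (\<integral>\<^sup>+ p. \<integral>\<^sup>+ p'. h (p, p') * f p \<partial>\<gamma>2 \<partial>\<gamma>1)"
      by (subst g2.nn_integral_fst[symmetric]) auto
    also have "\<dots> = (\<integral>\<^sup>+ p. (\<integral>\<^sup>+ p'. h (p, p') \<partial>\<gamma>2) * f p \<partial>\<gamma>1)"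
      by (intro nn_integral_cong nn_integral_multc) measurable
    also have "\<dots> = (\<integral>\<^sup>+ p. f p \<partial>\<gamma>1)"
      by (rule nn_integral_cong_AE) (use AE1 in \<open>eventually_elim, simp add: sec1\<close>)
    finally show ?thesis .
  qed
  have int2: "(\<integral>\<^sup>+ z. h z * f (snd z) \<partial>(\<gamma>1 \<Otimes>\<^sub>M \<gamma>2)) = (\<integral>\<^sup>+ p. f p \<partial>\<gamma>2)"
    if [measurable]: "f \<in> borel_measurable (borel \<Otimes>\<^sub>M borel)" for f
  proof -
    have "(\<integral>\<^sup>+ z. h z * f (snd z) \<partial>(\<gamma>1 \<Otimes>\<^sub>M \<gamma>2)) = (\<integral>\<^sup>+ p'. \<integral>\<^sup>+ p. h (p, p') * f p' \<partial>\<gamma>1 \<partial>\<gamma>2)"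
      by (subst nn_integral_snd[symmetric]) auto
    also have "\<dots> = (\<integral>\<^sup>+ p'. (\<integral>\<^sup>+ p. h (p, p') \<partial>\<gamma>1) * f p' \<partial>\<gamma>2)"
      by (intro nn_integral_cong nn_integral_multc) measurable
    also have "\<dots> = (\<integral>\<^sup>+ p. f p \<partial>\<gamma>2)"
      by (rule nn_integral_cong_AE) (use AE2 in \<open>eventually_elim, simp add: sec2\<close>)
    finally show ?thesis .
  qed
  define T where "T = (\<lambda>z :: ('a \<times> 'a) \<times> ('a \<times> 'a). (fst (fst z), snd (snd z)))"
  have [measurable]: "T \<in> measurable (\<gamma>1 \<Otimes>\<^sub>M \<gamma>2) (borel \<Otimes>\<^sub>M borel)"
    unfolding T_def by measurable
  define \<gamma> where "\<gamma> = distr (density (\<gamma>1 \<Otimes>\<^sub>M \<gamma>2) h) (borel \<Otimes>\<^sub>M borel) T"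
  have int: "(\<integral>\<^sup>+ p. f p \<partial>\<gamma>) = (\<integral>\<^sup>+ z. h z * f (T z) \<partial>(\<gamma>1 \<Otimes>\<^sub>M \<gamma>2))"
    if [measurable]: "f \<in> borel_measurable (borel \<Otimes>\<^sub>M borel)" for f
    unfolding \<gamma>_def by (simp add: nn_integral_distr nn_integral_density)
  have sg [measurable_cong]: "sets \<gamma> = sets (borel \<Otimes>\<^sub>M borel)" unfolding \<gamma>_def by simp
  have "distr \<gamma> borel fst = \<mu>"
  proof (rule measure_eqI)
    fix A :: "'a set" assume "A \<in> sets (distr \<gamma> borel fst)"
    then have [measurable]: "A \<in> sets borel" by simp
    have "emeasure (distr \<gamma> borel fst) A = (\<integral>\<^sup>+ x. indicator A x \<partial>distr \<gamma> borel fst)" by simp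
    also have "\<dots> = (\<integral>\<^sup>+ p. indicator A (fst p) \<partial>\<gamma>)"
      by (simp add: nn_integral_distr del: nn_integral_indicator)
    also have "\<dots> = (\<integral>\<^sup>+ z. h z * indicator A (fst (fst z)) \<partial>(\<gamma>1 \<Otimes>\<^sub>M \<gamma>2))"
      by (subst int) (simp_all add: T_def)
    also have "\<dots> = (\<integral>\<^sup>+ p. indicator A (fst p) \<partial>\<gamma>1)" by (rule int1) simp
    also have "\<dots> = (\<integral>\<^sup>+ x. indicator A x \<partial>\<mu>)" by (rule couplings_nn_integral(1)[OF g1]) simp
    also have "\<dots> = emeasure \<mu> A" by (rule nn_integral_indicator) (simp add: m1(1)[symmetric])
    finally show "emeasure (distr \<gamma> borel fst) A = emeasure \<mu> A" .
  qed (simp add: m1(1)[symmetric])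
  moreover have "distr \<gamma> borel snd = \<nu>"
  proof (rule measure_eqI)
    fix A :: "'a set" assume "A \<in> sets (distr \<gamma> borel snd)"
    then have [measurable]: "A \<in> sets borel" by simp
    have "emeasure (distr \<gamma> borel snd) A = (\<integral>\<^sup>+ x. indicator A x \<partial>distr \<gamma> borel snd)" by simp
    also have "\<dots> = (\<integral>\<^sup>+ p. indicator A (snd p) \<partial>\<gamma>)"
      by (simp add: nn_integral_distr del: nn_integral_indicator)
    also have "\<dots> = (\<integral>\<^sup>+ z. h z * indicator A (snd (snd z)) \<partial>(\<gamma>1 \<Otimes>\<^sub>M \<gamma>2))"
      by (subst int) (simp_all add: T_def)
    also have "\<dots> = (\<integral>\<^sup>+ p. indicator A (snd p) \<partial>\<gamma>2)" by (rule int2) simp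
    also have "\<dots> = (\<integral>\<^sup>+ x. indicator A x \<partial>\<nu>)" by (rule couplings_nn_integral(2)[OF g2]) simp
    also have "\<dots> = emeasure \<nu> A" by (rule nn_integral_indicator) (simp add: m2(2)[symmetric])
    finally show "emeasure (distr \<gamma> borel snd) A = emeasure \<nu> A" .
  qed (simp add: m2(2)[symmetric])
  ultimately have "\<gamma> \<in> couplings \<mu> \<nu>" unfolding couplings_def using sg by simp
  moreover
  let ?d = "\<lambda>p :: 'a \<times> 'a. ennreal (dist (fst p) (snd p))"
  have "(\<integral>\<^sup>+ p. ?d p \<partial>\<gamma>) \<le> (\<integral>\<^sup>+ p. ?d p \<partial>\<gamma>1) + (\<integral>\<^sup>+ p. ?d p \<partial>\<gamma>2) + ennreal e"
  proof -
    \<comment> \<open>Where \<open>h\<close> is nonzero both middle points lie in one cell, so the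
      jump from \<open>y\<close> to \<open>y'\<close> costs at most \<open>e\<close>.\<close>
    have pt: "h z * ?d (T z) \<le> h z * ?d (fst z) + h z * ?d (snd z) + h z * ennreal e" for z
    proof (cases "h z = 0")
      case False
      obtain x y y' u where z: "z = ((x, y), (y', u))" by (metis prod.exhaust)
      have cc: "c y = c y'" using False unfolding h_def z by (auto split: if_splits)
      have "dist y y' \<le> e"
        using c_near[of y] c_near[of y'] dist_triangle2[of y y' "q (c y)"] unfolding cc by linarith
      then have "dist x u \<le> dist x y + dist y' u + e"
        using dist_triangle[of x u y] dist_triangle[of y u y'] by linarith
      then have "ennreal (dist x u) \<le> ennreal (dist x y + dist y' u + e)" by (rule ennreal_leI)
      also have "\<dots> = ennreal (dist x y) + ennreal (dist y' u) + ennreal e" using e by simp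
      finally have "?d (T z) \<le> ?d (fst z) + ?d (snd z) + ennreal e" by (simp add: T_def z)
      from mult_left_mono[OF this, of "h z"] show ?thesis by (simp add: distrib_left)
    qed simp
    have "(\<integral>\<^sup>+ p. ?d p \<partial>\<gamma>) = (\<integral>\<^sup>+ z. h z * ?d (T z) \<partial>(\<gamma>1 \<Otimes>\<^sub>M \<gamma>2))"
      by (rule int) simp
    also have "\<dots> \<le> (\<integral>\<^sup>+ z. h z * ?d (fst z) + h z * ?d (snd z) + h z * ennreal e \<partial>(\<gamma>1 \<Otimes>\<^sub>M \<gamma>2))"
      by (rule nn_integral_mono) (rule pt)
    also have "\<dots> = (\<integral>\<^sup>+ z. h z * ?d (fst z) \<partial>(\<gamma>1 \<Otimes>\<^sub>M \<gamma>2)) + (\<integral>\<^sup>+ z. h z * ?d (snd z) \<partial>(\<gamma>1 \<Otimes>\<^sub>M \<gamma>2))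
        + (\<integral>\<^sup>+ z. h z * ennreal e \<partial>(\<gamma>1 \<Otimes>\<^sub>M \<gamma>2))"
      by (simp add: nn_integral_add)
    also have "\<dots> = (\<integral>\<^sup>+ p. ?d p \<partial>\<gamma>1) + (\<integral>\<^sup>+ p. ?d p \<partial>\<gamma>2) + (\<integral>\<^sup>+ p. ennreal e \<partial>\<gamma>1)"
      using int1[of ?d] int2[of ?d] int1[of "\<lambda>_. ennreal e"] by simp
    finally show ?thesis by (simp add: g1.emeasure_space_1)
  qed
  ultimately show ?thesis by (rule that)
qed

text \<open>Each of the two couplings is optimal up to \<open>e / 3\<close>; the third
  \<open>e / 3\<close> pays for the gluing.\<close>

lemma transport_cost_triangle:
  fixes \<mu> m \<nu> :: "'a::metric_space measure"
    and q :: "nat \<Rightarrow> 'a"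
  assumes q: "\<And>x e. e > 0 \<Longrightarrow> \<exists>n. dist x (q n) < e"
    and m: "prob_space m"
  shows "transport_cost \<mu> \<nu> \<le> transport_cost \<mu> m + transport_cost m \<nu>"
proof (rule ennreal_le_epsilon)
  fix e :: real assume fin: "transport_cost \<mu> m + transport_cost m \<nu> < top" and e: "0 < e"
  have lt: "t < t + ennreal (e / 3)" if "t < top" for t :: ennreal
    using that e ennreal_add_left_cancel_less[of t 0 "ennreal (e/3)"] by simp
  have "transport_cost \<mu> m < transport_cost \<mu> m + ennreal (e / 3)"
    using fin by (intro lt) (auto simp: less_top)
  then obtain \<gamma>1 where g1: "\<gamma>1 \<in> couplings \<mu> m"
    "(\<integral>\<^sup>+ p. ennreal (dist (fst p) (snd p)) \<partial>\<gamma>1) < transport_cost \<mu> m + ennreal (e / 3)"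
    unfolding transport_cost_def by (subst (asm) INF_less_iff) blast
  have "transport_cost m \<nu> < transport_cost m \<nu> + ennreal (e / 3)"
    using fin by (intro lt) (auto simp: less_top)
  then obtain \<gamma>2 where g2: "\<gamma>2 \<in> couplings m \<nu>"
    "(\<integral>\<^sup>+ p. ennreal (dist (fst p) (snd p)) \<partial>\<gamma>2) < transport_cost m \<nu> + ennreal (e / 3)"
    unfolding transport_cost_def by (subst (asm) INF_less_iff) blast
  have "e / 3 > 0" using e by simp
  then obtain \<gamma> where g: "\<gamma> \<in> couplings \<mu> \<nu>"
    "(\<integral>\<^sup>+ p. ennreal (dist (fst p) (snd p)) \<partial>\<gamma>)
      \<le> (\<integral>\<^sup>+ p. ennreal (dist (fst p) (snd p)) \<partial>\<gamma>1) + (\<integral>\<^sup>+ p. ennreal (dist (fst p) (snd p)) \<partial>\<gamma>2) + ennreal (e / 3)"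
    using approximate_gluing[OF q m g1(1) g2(1)] by blast
  have "transport_cost \<mu> \<nu> \<le> (\<integral>\<^sup>+ p. ennreal (dist (fst p) (snd p)) \<partial>\<gamma>)"
    unfolding transport_cost_def by (rule INF_lower[OF g(1)])
  also note g(2)
  also have "(\<integral>\<^sup>+ p. ennreal (dist (fst p) (snd p)) \<partial>\<gamma>1) + (\<integral>\<^sup>+ p. ennreal (dist (fst p) (snd p)) \<partial>\<gamma>2) + ennreal (e / 3)
    \<le> (transport_cost \<mu> m + ennreal (e / 3)) + (transport_cost m \<nu> + ennreal (e / 3)) + ennreal (e / 3)"
    using g1(2) g2(2) by (intro add_mono) auto
  also have "\<dots> = transport_cost \<mu> m + transport_cost m \<nu> + (ennreal (e / 3) + ennreal (e / 3) + ennreal (e / 3))"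
    by (simp add: ac_simps)
  also have "ennreal (e / 3) + ennreal (e / 3) + ennreal (e / 3) = ennreal e"
    using e by (simp add: ennreal_plus[symmetric] del: ennreal_plus)
  finally show "transport_cost \<mu> \<nu> \<le> transport_cost \<mu> m + transport_cost m \<nu> + ennreal e" .
qed

subsection \<open>Coding a proper space into the real line\<close>

text \<open>Serves to recognize the marginals of a narrow limit of couplings. Closed sets are an
  intersection-stable generator, and the indicator of a closed set is the pointwise limit of
  continuous functions that decay with slope \<open>n\<close> away from it.\<close>

lemma measure_eqI_bounded_continuous:
  fixes M N :: "'a::metric_space measure"
  assumes "finite_measure M" "finite_measure N" and s: "sets M = sets borel" "sets N = sets borel"
    and eq: "\<And>f :: 'a \<Rightarrow> real. continuous_on UNIV f \<Longrightarrow> bounded (range f) \<Longrightarrow> integral\<^sup>L M f = integral\<^sup>L N f"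
  shows "M = N"
proof -
  interpret M: finite_measure M by fact
  interpret N: finite_measure N by fact
  have sp: "space M = UNIV" "space N = UNIV"
    using sets_eq_imp_space_eq[OF s(1)] sets_eq_imp_space_eq[OF s(2)] by simp_all
  \<comment> \<open>The empty set is treated separately: \<open>infdist x {}\<close> is 0, so its
    approximants would be constantly 1.\<close>
  have lim: "(\<lambda>n. \<integral>x. max 0 (1 - real n * infdist x F) \<partial>L) \<longlonglongrightarrow> measure L F"
    if F: "closed F" "F \<noteq> {}" and "finite_measure L" and sL: "sets L = sets borel" for L :: "'a measure" and F
  proof -
    interpret L: finite_measure L by fact
    note [measurable_cong] = sL
    have spL: "space L = UNIV" using sets_eq_imp_space_eq[OF sL] by simp
    have [measurable]: "F \<in> sets borel" using F by simp
    have [measurable]: "(\<lambda>x. infdist x F) \<in> borel_measurable borel"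
      by (intro borel_measurable_continuous_onI continuous_intros)
    have "(\<lambda>n. \<integral>x. max 0 (1 - real n * infdist x F) \<partial>L) \<longlonglongrightarrow> (\<integral>x. indicator F x \<partial>L)"
    proof (rule integral_dominated_convergence[where w="\<lambda>_. 1"])
      show "AE x in L. (\<lambda>n. max 0 (1 - real n * infdist x F)) \<longlonglongrightarrow> indicator F x"
      proof (rule AE_I2)
        fix x
        show "(\<lambda>n. max 0 (1 - real n * infdist x F)) \<longlonglongrightarrow> indicator F x"
        proof (cases "x \<in> F")
          case True
          then show ?thesis by simp
        next
          case False
          then have pos: "infdist x F > 0" using infdist_pos_not_in_closed[OF F] by blast
          obtain n0 where n0: "1 < real n0 * infdist x F" using reals_Archimedean3[OF pos] by blast
          have "\<forall>\<^sub>F n in sequentially. max 0 (1 - real n * infdist x F) = 0"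
            using eventually_ge_at_top[of n0]
          proof eventually_elim
            case (elim n)
            then have "real n0 * infdist x F \<le> real n * infdist x F"
              using pos by (intro mult_right_mono) auto
            then show ?case using n0 by simp
          qed
          then show ?thesis using False by (simp add: tendsto_eventually)
        qed
      qed
      show "AE x in L. norm (max 0 (1 - real n * infdist x F)) \<le> 1" for n
        by (rule AE_I2) (simp add: infdist_nonneg)
    qed auto
    then show ?thesis by (simp add: spL)
  qed
  have "emeasure M F = emeasure N F" if F: "closed F" for F
  proof (cases "F = {}")
    case False
    have "(\<integral>x. max 0 (1 - real n * infdist x F) \<partial>M) = (\<integral>x. max 0 (1 - real n * infdist x F) \<partial>N)" for n
    proof (rule eq)
      show "bounded (range (\<lambda>x. max 0 (1 - real n * infdist x F)))"
        by (rule boundedI[of _ 1]) (auto simp: infdist_nonneg)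
    qed (intro continuous_intros)
    then have "measure M F = measure N F"
      using LIMSEQ_unique[OF lim[OF F False \<open>finite_measure M\<close> s(1)]]
        lim[OF F False \<open>finite_measure N\<close> s(2)] by simp
    then show ?thesis by (simp add: M.emeasure_eq_measure N.emeasure_eq_measure)
  qed simp
  then show ?thesis
    using s by (intro measure_eqI_generator_eq[where E="Collect closed" and \<Omega>=UNIV and A="\<lambda>_. UNIV"])
      (auto simp: Int_stable_def borel_eq_closed M.emeasure_eq_measure)
qed

text \<open>The usual parametrization of the Cantor ternary set. Digits 0 and 2 leave gaps, so
  sufficiently close values share their initial digits, which binary expansions do not
  ensure.\<close>

definition cantor :: "(nat \<Rightarrow> bool) \<Rightarrow> real" where
  "cantor a = (\<Sum>k. of_bool (a k) * 2 / 3 ^ Suc k)"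

lemma cantor_summable: "summable (\<lambda>k. of_bool (a k) * 2 / 3 ^ Suc k :: real)"
proof (rule summable_comparison_test')
  show "summable (\<lambda>k. 2 / 3 * (1 / 3) ^ k :: real)" by (intro summable_mult summable_geometric) simp
  show "norm (of_bool (a k) * 2 / 3 ^ Suc k :: real) \<le> 2 / 3 * (1 / 3) ^ k" for k
    by (simp add: power_divide)
qed

lemma cantor_Suc: "cantor a = of_bool (a 0) * 2 / 3 + cantor (\<lambda>k. a (Suc k)) / 3"
proof -
  have "cantor a = of_bool (a 0) * 2 / 3 + (\<Sum>k. of_bool (a (Suc k)) * 2 / 3 ^ Suc (Suc k))"
    unfolding cantor_def using suminf_split_head[OF cantor_summable[of a]] by simp
  also have "(\<Sum>k. of_bool (a (Suc k)) * 2 / 3 ^ Suc (Suc k)) = cantor (\<lambda>k. a (Suc k)) / 3"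
    unfolding cantor_def using suminf_divide[OF cantor_summable[of "\<lambda>k. a (Suc k)"], of 3]
    by (simp add: mult.commute)
  finally show ?thesis .
qed

lemma cantor_bounds: "0 \<le> cantor a" "cantor a \<le> 1"
proof -
  show "0 \<le> cantor a" unfolding cantor_def by (intro suminf_nonneg cantor_summable) simp
  have g: "summable (\<lambda>k. 2 / 3 * (1 / 3) ^ k :: real)" by (intro summable_mult summable_geometric) simp
  have "cantor a \<le> (\<Sum>k. 2 / 3 * (1 / 3) ^ k)"
    unfolding cantor_def by (intro suminf_le cantor_summable g) (simp add: power_divide)
  also have "\<dots> = 1" by (subst suminf_mult) (auto simp: suminf_geometric intro!: summable_geometric)
  finally show "cantor a \<le> 1" .
qed

text \<open>At the first differing digit, of index k < K, the sums differ by
  \<open>2 / 3 ^ Suc k\<close>, while the tails differ by at most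
  \<open>1 / 3 ^ Suc k\<close>.\<close>

lemma cantor_separated:
  assumes "\<exists>k<K. a k \<noteq> b k"
  shows "1 / 3 ^ K \<le> \<bar>cantor a - cantor b\<bar>"
  using assms
proof (induction K arbitrary: a b)
  case (Suc K)
  let ?a = "\<lambda>k. a (Suc k)" and ?b = "\<lambda>k. b (Suc k)"
  show ?case
  proof (cases "a 0 = b 0")
    case True
    then have "\<exists>k<K. ?a k \<noteq> ?b k" using Suc.prems by (metis Suc_less_SucD not0_implies_Suc)
    from Suc.IH[OF this] show ?thesis
      using True by (simp add: cantor_Suc[of a] cantor_Suc[of b] abs_if split: if_splits)
  next
    case False
    then have "1 / 3 \<le> \<bar>cantor a - cantor b\<bar>"
      using cantor_bounds[of ?a] cantor_bounds[of ?b]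
      by (cases "a 0"; cases "b 0") (simp_all add: cantor_Suc[of a] cantor_Suc[of b])
    moreover have "(1::real) / 3 ^ Suc K \<le> 1 / 3" by (simp add: field_simps)
    ultimately show ?thesis by linarith
  qed
qed simp

text \<open>The code records \<open>\<lfloor>d(x\<^sub>0, x)\<rfloor>\<close> and, as ternary digits, membership in a countable family of balls.\<close>

lemma proper_real_coding:
  fixes x0 :: "'a::metric_space"
  assumes proper: "\<forall>(x::'a) r. compact (cball x r)"
  obtains s :: "'a \<Rightarrow> real" where "s \<in> borel_measurable borel"
    "\<And>x. 0 \<le> s x" "\<And>x. s x \<le> 2 * dist x0 x + 1" "\<And>x. dist x0 x \<le> s x / 2 + 1"
    "\<And>B e. e > 0 \<Longrightarrow> \<exists>\<delta>>0. \<forall>x x'. dist x0 x \<le> B \<longrightarrow> \<bar>s x - s x'\<bar> < \<delta> \<longrightarrow> dist x x' < e"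
proof -
  obtain q :: "nat \<Rightarrow> 'a" where q: "\<And>x e. e > 0 \<Longrightarrow> \<exists>n. dist x (q n) < e"
    using proper_dense_sequence[OF proper] by blast
  \<comment> \<open>\<open>prod_decode\<close> lists all balls with centre \<open>q i\<close> and
    radius 1/(j+1) under a single index, the position of the ternary digit.\<close>
  define A where "A k = ball (q (fst (prod_decode k))) (inverse (real (Suc (snd (prod_decode k)))))" for k
  define t where "t x = cantor (\<lambda>k. x \<in> A k)" for x
  \<comment> \<open>The factor 2 separates the integer part from \<open>t\<close>, which ranges
    within [0,1]: points with different floors have codes at distance at least 1. The floor makes
    the code comparable to the distance from \<open>x0\<close> in both directions.\<close>
  define s where "s x = 2 * real_of_int \<lfloor>dist x0 x\<rfloor> + t x" for x
  have t01: "0 \<le> t x" "t x \<le> 1" for x unfolding t_def by (rule cantor_bounds)+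
  show ?thesis
  proof (rule that[of s])
    have [measurable]: "A k \<in> sets borel" for k unfolding A_def by simp
    have [measurable]: "dist x0 \<in> borel_measurable borel"
      by (intro borel_measurable_continuous_onI continuous_intros)
    show "s \<in> borel_measurable borel"
      unfolding s_def t_def cantor_def of_bool_def by measurable
  next
    fix x
    show "0 \<le> s x" unfolding s_def using t01[of x] by simp
    show "s x \<le> 2 * dist x0 x + 1" unfolding s_def using t01[of x] by linarith
    have "dist x0 x < real_of_int \<lfloor>dist x0 x\<rfloor> + 1" by linarith
    then show "dist x0 x \<le> s x / 2 + 1" unfolding s_def add_divide_distrib using t01[of x] by linarith
  next
    fix B e :: real assume e: "e > 0"
    obtain j where j: "inverse (real (Suc j)) < e / 2"
      using reals_Archimedean[of "e / 2"] e by auto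
    define r where "r = inverse (real (Suc j))"
    have r: "r > 0" unfolding r_def by simp
    have "cball x0 B \<subseteq> (\<Union>i. ball (q i) r)"
      using q[OF r] by (auto simp: dist_commute)
    then obtain I where I: "finite I" "cball x0 B \<subseteq> (\<Union>i\<in>I. ball (q i) r)"
      using compactE_image[OF proper[rule_format, of x0 B], of UNIV "\<lambda>i. ball (q i) r"] by auto
    \<comment> \<open>Finitely many balls of radius below \<open>e / 2\<close> cover
      \<open>cball x0 B\<close>; \<open>K\<close> exceeds the digit positions of all of them, so the
      first \<open>K\<close> digits locate a point of that ball up to \<open>e\<close>.\<close>
    define K where "K = Suc (\<Sum>i\<in>I. prod_encode (i, j))"
    have K: "prod_encode (i, j) < K" if "i \<in> I" for i
      unfolding K_def using member_le_sum[OF that, of "\<lambda>i. prod_encode (i, j)"] I(1) by simp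
    show "\<exists>\<delta>>0. \<forall>x x'. dist x0 x \<le> B \<longrightarrow> \<bar>s x - s x'\<bar> < \<delta> \<longrightarrow> dist x x' < e"
    proof (intro exI[of _ "1 / 3 ^ K"] conjI allI impI)
      fix x x' assume x: "dist x0 x \<le> B" and ss: "\<bar>s x - s x'\<bar> < 1 / 3 ^ K"
      have "(1::real) / 3 ^ K \<le> 1" by simp
      then have "\<bar>s x - s x'\<bar> < 1" using ss by linarith
      then have "\<lfloor>dist x0 x\<rfloor> = \<lfloor>dist x0 x'\<rfloor>"
        unfolding s_def using t01[of x] t01[of x'] by linarith
      then have "\<bar>t x - t x'\<bar> < 1 / 3 ^ K" using ss by (simp add: s_def)
      then have same: "x \<in> A k \<longleftrightarrow> x' \<in> A k" if "k < K" for k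
        using cantor_separated[of K "\<lambda>k. x \<in> A k" "\<lambda>k. x' \<in> A k"] that unfolding t_def by force
      have "x \<in> cball x0 B" using x by simp
      then obtain i where i: "i \<in> I" "x \<in> ball (q i) r" using I(2) by blast
      then have "x' \<in> ball (q i) r" using same[OF K[OF i(1)]] unfolding A_def r_def by simp
      then have "dist x x' < 2 * r"
        using i(2) dist_triangle3[of x x' "q i"] by simp
      then show "dist x x' < e" using j unfolding r_def by simp
    qed simp
  qed
qed

subsection \<open>Narrow convergence and semicontinuity\<close>

definition narrowly_converges :: "(nat \<Rightarrow> 'a::topological_space measure) \<Rightarrow> 'a measure \<Rightarrow> bool" where
  "narrowly_converges M M' \<longleftrightarrow> (\<forall>f :: 'a \<Rightarrow> real. continuous_on UNIV f \<longrightarrow> bounded (range f) \<longrightarrow>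
    (\<lambda>k. integral\<^sup>L (M k) f) \<longlonglongrightarrow> integral\<^sup>L M' f)"

lemma narrowly_convergesD:
  fixes f :: "'a::topological_space \<Rightarrow> real"
  assumes "narrowly_converges M M'" "continuous_on UNIV f" "bounded (range f)"
  shows "(\<lambda>k. integral\<^sup>L (M k) f) \<longlonglongrightarrow> integral\<^sup>L M' f"
  using assms by (auto simp: narrowly_converges_def)

text \<open>Markov's inequality, passed to the complement.\<close>

lemma bounded_moment_tail:
  fixes x0 :: "'a::metric_space"
  assumes "prob_space M" and s: "sets M = sets borel"
    and mom: "(\<integral>\<^sup>+ x. ennreal (dist x0 x) \<partial>M) \<le> ennreal C" and C: "0 \<le> C" and t: "t > 0"
  shows "1 - C / t \<le> measure M {x. dist x0 x < t}"
proof -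
  interpret prob_space M by fact
  note [measurable_cong] = s
  have sp: "space M = UNIV" using sets_eq_imp_space_eq[OF s] by simp
  have [measurable]: "dist x0 \<in> borel_measurable borel"
    by (intro borel_measurable_continuous_onI continuous_intros)
  have meas: "{x. t \<le> dist x0 x} \<in> sets M" "{x. dist x0 x < t} \<in> sets M"
    by (simp_all add: s borel_closed borel_open closed_Collect_le open_Collect_less continuous_intros)
  have "ennreal t * emeasure M {x. t \<le> dist x0 x} = (\<integral>\<^sup>+ x. ennreal t * indicator {x. t \<le> dist x0 x} x \<partial>M)"
    using meas by (simp add: nn_integral_cmult_indicator)
  also have "\<dots> \<le> (\<integral>\<^sup>+ x. ennreal (dist x0 x) \<partial>M)"
    by (intro nn_integral_mono) (auto simp: indicator_def intro: ennreal_leI)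
  also note mom
  finally have "ennreal (t * measure M {x. t \<le> dist x0 x}) \<le> ennreal C"
    using t by (simp add: emeasure_eq_measure ennreal_mult)
  then have "t * measure M {x. t \<le> dist x0 x} \<le> C" using C by simp
  then have "measure M {x. t \<le> dist x0 x} \<le> C / t" using t by (simp add: field_simps)
  moreover have "measure M {x. dist x0 x < t} = 1 - measure M {x. t \<le> dist x0 x}"
  proof -
    have "space M - {x. t \<le> dist x0 x} = {x. dist x0 x < t}" by (auto simp: sp)
    then show ?thesis using prob_compl[OF meas(1)] by simp
  qed
  ultimately show ?thesis by simp
qed

text \<open>Helly's selection theorem is applied to the images under the real coding; the inverse of the
  coding extends continuously to the closure of its range, and carries the limit back.\<close>

lemma bounded_moment_narrow_subsequence:
  fixes M :: "nat \<Rightarrow> 'a::metric_space measure" and x0 :: 'a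
  assumes proper: "\<forall>(x::'a) r. compact (cball x r)"
    and pM: "\<And>k. prob_space (M k)" and sM: "\<And>k. sets (M k) = sets borel"
    and mom: "\<And>k. (\<integral>\<^sup>+ x. ennreal (dist x0 x) \<partial>M k) \<le> ennreal C" and C: "0 \<le> C"
  obtains r M' where "strict_mono (r :: nat \<Rightarrow> nat)" "prob_space M'" "sets M' = sets borel"
    "narrowly_converges (M \<circ> r) M'"
proof -
  note [measurable_cong] = sM
  interpret M: prob_space "M k" for k by (rule pM)
  obtain s :: "'a \<Rightarrow> real" where s_meas [measurable]: "s \<in> borel_measurable borel"
    and s: "\<And>x. 0 \<le> s x" "\<And>x. s x \<le> 2 * dist x0 x + 1" "\<And>x. dist x0 x \<le> s x / 2 + 1"
    and uc: "\<And>B e. e > 0 \<Longrightarrow> \<exists>\<delta>>0. \<forall>x x'. dist x0 x \<le> B \<longrightarrow> \<bar>s x - s x'\<bar> < \<delta> \<longrightarrow> dist x x' < e"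
    using proper_real_coding[OF proper, of x0] by blast
  define R where "R k = distr (M k) borel s" for k
  have R: "real_distribution (R k)" for k
    unfolding R_def by (rule M.real_distribution_distr) simp
  have "tight R"
    unfolding tight_def
  proof (intro conjI allI impI R)
    fix \<epsilon> :: real assume \<epsilon>: "\<epsilon> > 0"
    \<comment> \<open>Chosen so that C / t = C \<epsilon> / (C + 1) < \<epsilon>; the summand 1
      keeps \<open>t\<close> positive when C = 0.\<close>
    define t where "t = (C + 1) / \<epsilon>"
    have t: "t > 0" unfolding t_def using C \<epsilon> by simp
    have "C / t < \<epsilon>" unfolding t_def using C \<epsilon> by (simp add: field_simps)
    \<comment> \<open>Points with \<open>dist x0 x < t\<close> have codes in [0, 2 t + 1]; the
      endpoint -1 admits the code 0 into a half-open interval.\<close>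
    show "\<exists>a b. a < b \<and> (\<forall>k. 1 - \<epsilon> < measure (R k) {a<..b})"
    proof (rule exI[of _ "-1"], rule exI[of _ "2 * t + 1"], intro conjI allI)
      fix k
      have "1 - \<epsilon> < 1 - C / t" using \<open>C / t < \<epsilon>\<close> by simp
      also have "\<dots> \<le> measure (M k) {x. dist x0 x < t}"
        by (rule bounded_moment_tail[OF pM sM mom C t])
      also have "\<dots> \<le> measure (M k) (s -` {-1<..2 * t + 1})"
      proof (rule M.finite_measure_mono)
        have "- 1 < s x \<and> s x \<le> 2 * t + 1" if "dist x0 x < t" for x
          using s(1)[of x] s(2)[of x] that by linarith
        then show "{x. dist x0 x < t} \<subseteq> s -` {-1<..2 * t + 1}" by auto
        show "s -` {-1<..2 * t + 1} \<in> M.events k"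
          using measurable_sets[OF s_meas, of "{-1<..2 * t + 1}"] by (simp add: sM)
      qed
      also have "\<dots> = measure (R k) {-1<..2 * t + 1}"
        unfolding R_def by (subst measure_distr) (simp_all add: sets_eq_imp_space_eq[OF sM])
      finally show "1 - \<epsilon> < measure (R k) {-1<..2 * t + 1}" .
    qed (use t in simp)
  qed
  then obtain r L where r: "strict_mono (r :: nat \<Rightarrow> nat)" and L: "real_distribution L"
    and conv: "weak_conv_m (R \<circ> r) L"
    using tight_imp_convergent_subsubsequence[of R id] by (auto simp: strict_mono_id)
  interpret L: real_distribution L by (rule L)
  have convI: "(\<lambda>k. integral\<^sup>L (M (r k)) (\<lambda>x. g (s x))) \<longlonglongrightarrow> integral\<^sup>L L g"
    if g: "continuous_on UNIV g" "\<And>y. \<bar>g y\<bar> \<le> B" for g :: "real \<Rightarrow> real" and B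
  proof -
    have [measurable]: "g \<in> borel_measurable borel" using g(1) by (rule borel_measurable_continuous_onI)
    have "(\<lambda>k. integral\<^sup>L ((R \<circ> r) k) g) \<longlonglongrightarrow> integral\<^sup>L L g"
      using g conv R L
      by (intro weak_conv_imp_integral_bdd_continuous_conv[where B=B])
         (auto simp: continuous_on_eq_continuous_at comp_def)
    then show ?thesis by (simp add: R_def integral_distr)
  qed

  \<comment> \<open>The set of codes need not be closed, and a priori \<open>L\<close> may charge
    limits of codes that are not codes, so the inverse is built on the closure.\<close>
  define E where "E = closure (range s)"
  have E: "closed E" "E \<noteq> {}" "\<And>x. s x \<in> E"
    unfolding E_def using closure_subset[of "range s"] by auto
  \<comment> \<open>\<open>P y p\<close> says that \<open>p\<close> is a limit of points whose codes
    tend to \<open>y\<close>; \<open>f\<close> picks such a limit, and its value \<open>x0\<close>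
    off \<open>E\<close> is an arbitrary default.\<close>
  define P where "P y p \<longleftrightarrow> (\<forall>e>0. \<exists>x. \<bar>s x - y\<bar> < e \<and> dist x p < e)" for y p
  define f where "f y = (if y \<in> E then SOME p. P y p else x0)" for y
  have Pf: "P y (f y)" if y: "y \<in> E" for y
  proof -
    have "\<exists>x. \<bar>s x - y\<bar> < inverse (real (Suc n))" for n
      using y unfolding E_def closure_approachable by (auto simp: dist_real_def)
    then obtain x where x: "\<And>n. \<bar>s (x n) - y\<bar> < inverse (real (Suc n))" by metis
    \<comment> \<open>The code controls the distance from \<open>x0\<close>, so points with codes
      near \<open>y\<close> stay in a fixed ball, and properness gives a limit point.\<close>
    have "x n \<in> cball x0 ((y + 1) / 2 + 1)" for n
    proof -
      have "inverse (real (Suc n)) \<le> 1" by (simp add: field_simps)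
      then have "s (x n) < y + 1" using x[of n] by linarith
      then have "s (x n) / 2 + 1 \<le> (y + 1) / 2 + 1" by simp
      with s(3)[of "x n"] show ?thesis unfolding mem_cball by (rule order_trans)
    qed
    then obtain p u where u: "strict_mono (u :: nat \<Rightarrow> nat)" "(x \<circ> u) \<longlonglongrightarrow> p"
      using proper[rule_format, of x0 "(y + 1) / 2 + 1"] unfolding compact_def by metis
    have "P y p"
      unfolding P_def
    proof (intro allI impI)
      fix e :: real assume e: "e > 0"
      obtain n0 where n0: "inverse (real (Suc n0)) < e" using reals_Archimedean[OF e] by blast
      have "\<forall>\<^sub>F n in sequentially. dist ((x \<circ> u) n) p < e" using u(2) e by (rule tendstoD)
      then have "\<forall>\<^sub>F n in sequentially. n0 \<le> n \<and> dist ((x \<circ> u) n) p < e"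
        using eventually_ge_at_top[of n0] by eventually_elim simp
      then obtain n where n: "n0 \<le> n" "dist (x (u n)) p < e"
        by (auto simp: eventually_sequentially)
      have "n0 \<le> u n" using seq_suble[OF u(1), of n] n(1) by simp
      then have "inverse (real (Suc (u n))) \<le> inverse (real (Suc n0))" by (intro le_imp_inverse_le) auto
      then have "\<bar>s (x (u n)) - y\<bar> < e" using x[of "u n"] n0 by linarith
      then show "\<exists>x. \<bar>s x - y\<bar> < e \<and> dist x p < e" using n(2) by blast
    qed
    then show ?thesis using y unfolding f_def by (auto intro: someI[of "P y"])
  qed
  \<comment> \<open>By \<open>uc\<close>, points with codes near \<open>s x\<close> are near
    \<open>x\<close>, so the points approximating \<open>f (s x)\<close> cannot converge
    elsewhere.\<close>
  have fs: "f (s x) = x" for x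
  proof (rule ccontr)
    assume "f (s x) \<noteq> x"
    then have d: "dist x (f (s x)) / 2 > 0" by simp
    obtain \<delta> where \<delta>: "\<delta> > 0" "\<And>x'. \<bar>s x - s x'\<bar> < \<delta> \<Longrightarrow> dist x x' < dist x (f (s x)) / 2"
      using uc[OF d, of "dist x0 x"] by blast
    have "min \<delta> (dist x (f (s x)) / 2) > 0" using \<delta>(1) d by simp
    then obtain x' where x': "\<bar>s x' - s x\<bar> < \<delta>" "dist x' (f (s x)) < dist x (f (s x)) / 2"
      using Pf[OF E(3), of x] unfolding P_def by (metis min_less_iff_conj)
    have "dist x x' < dist x (f (s x)) / 2" using \<delta>(2)[of x'] x'(1) by (simp add: abs_minus_commute)
    then show False using x'(2) dist_triangle[of x "f (s x)" x'] by linarith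
  qed
  have f_cont: "continuous_on E f"
    unfolding continuous_on_iff
  proof (intro ballI allI impI)
    fix y e :: real assume y: "y \<in> E" and e: "e > 0"
    have e3: "e / 3 > 0" using e by simp
    obtain \<delta> where \<delta>: "\<delta> > 0"
      "\<And>x x'. dist x0 x \<le> (y + 1) / 2 + 1 \<Longrightarrow> \<bar>s x - s x'\<bar> < \<delta> \<Longrightarrow> dist x x' < e / 3"
      using uc[OF e3, of "(y + 1) / 2 + 1"] by blast
    show "\<exists>d>0. \<forall>y'\<in>E. dist y' y < d \<longrightarrow> dist (f y') (f y) < e"
    proof (intro exI[of _ "\<delta> / 3"] conjI ballI impI)
      fix y' assume y': "y' \<in> E" "dist y' y < \<delta> / 3"
      \<comment> \<open>The bound 1 keeps \<open>x\<close> in the ball where \<open>\<delta>\<close>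
        works, and \<open>x'\<close> need not lie there; the other two give a third of
        \<open>\<delta>\<close> and of \<open>e\<close> to each approximation.\<close>
      have m: "min 1 (min (\<delta> / 3) (e / 3)) > 0" using \<delta>(1) e by simp
      obtain x where x: "\<bar>s x - y\<bar> < min 1 (min (\<delta> / 3) (e / 3))" "dist x (f y) < min 1 (min (\<delta> / 3) (e / 3))"
        using Pf[OF y] m unfolding P_def by blast
      obtain x' where x': "\<bar>s x' - y'\<bar> < min 1 (min (\<delta> / 3) (e / 3))" "dist x' (f y') < min 1 (min (\<delta> / 3) (e / 3))"
        using Pf[OF y'(1)] m unfolding P_def by blast
      have "s x < y + 1" using x(1) by linarith
      then have "s x / 2 + 1 \<le> (y + 1) / 2 + 1" by simp
      with s(3)[of x] have "dist x0 x \<le> (y + 1) / 2 + 1" by (rule order_trans)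
      moreover have "\<bar>s x - s x'\<bar> < \<delta>" using x(1) x'(1) y'(2) unfolding dist_real_def by linarith
      ultimately have "dist x x' < e / 3" by (rule \<delta>(2))
      then show "dist (f y') (f y) < e"
        using x(2) x'(2) dist_triangle[of "f y'" "f y" x'] dist_triangle[of x' "f y" x]
          dist_commute[of x x'] dist_commute[of x' "f y'"] by linarith
    qed (use \<delta>(1) in simp)
  qed
  have f_eq: "f = (\<lambda>y. if y \<in> E then f y else x0)" unfolding f_def by auto
  have f_meas [measurable]: "f \<in> borel_measurable borel"
    by (subst f_eq) (intro borel_measurable_continuous_on_if f_cont borel_closed E continuous_intros)
  \<comment> \<open>\<open>min 1 (infdist y E)\<close> is bounded, continuous and zero at every
    code, so its integral against \<open>L\<close> is a limit of zeros.\<close>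
  have AE_E: "AE y in L. y \<in> E"
  proof -
    let ?g = "\<lambda>y. min 1 (infdist y E)"
    have g_cont: "continuous_on UNIV ?g" by (intro continuous_intros)
    have [measurable]: "?g \<in> borel_measurable borel"
      using g_cont by (rule borel_measurable_continuous_onI)
    have "(\<lambda>k. integral\<^sup>L (M (r k)) (\<lambda>x. ?g (s x))) \<longlonglongrightarrow> integral\<^sup>L L ?g"
      by (rule convI[OF g_cont, of 1]) (simp add: infdist_nonneg)
    moreover have "?g (s x) = 0" for x using E(3)[of x] by simp
    ultimately have "integral\<^sup>L L ?g = 0" by (simp add: LIMSEQ_const_iff)
    moreover have "integrable L ?g"
      by (rule L.integrable_const_bound[of _ 1]) (auto simp: infdist_nonneg)
    ultimately have "AE y in L. ?g y = 0"
      by (subst (asm) integral_nonneg_eq_0_iff_AE) (auto simp: infdist_nonneg)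
    then show ?thesis
      by eventually_elim (auto simp: in_closed_iff_infdist_zero[OF E(1,2)] min_def split: if_splits)
  qed
  show ?thesis
  proof (rule that[of r "distr L borel f"])
    show "strict_mono r" by fact
    show "prob_space (distr L borel f)" by (rule L.prob_space_distr) simp
    show "sets (distr L borel f) = sets borel" by simp
    show "narrowly_converges (M \<circ> r) (distr L borel f)"
      unfolding narrowly_converges_def
    proof (intro allI impI)
      fix h :: "'a \<Rightarrow> real" assume h: "continuous_on UNIV h" "bounded (range h)"
      then have [measurable]: "h \<in> borel_measurable borel" by (intro borel_measurable_continuous_onI)
      obtain B where B: "\<And>x. \<bar>h x\<bar> \<le> B" using h(2) unfolding bounded_iff by auto
      have "0 \<le> B" using B[of x0] by linarith
      \<comment> \<open>\<open>h\<close> composed with \<open>f\<close> is continuous on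
        \<open>E\<close> only; Tietze extends it with the same bound to a test function
        \<open>G\<close> on the line, and \<open>G (s x) = h x\<close> turns convergence of codes
        into convergence against \<open>h\<close>.\<close>
      have "continuous_on E (\<lambda>y. h (f y))"
        by (rule continuous_on_compose2[OF h(1) f_cont]) simp
      moreover have "closedin (top_of_set UNIV) E" using E(1) by simp
      moreover have "norm (h (f y)) \<le> B" for y using B by simp
      ultimately obtain G where G: "continuous_on UNIV G" "\<And>y. y \<in> E \<Longrightarrow> G y = h (f y)" "\<And>y. \<bar>G y\<bar> \<le> B"
        using Tietze[of E "\<lambda>y. h (f y)" UNIV B, OF _ _ \<open>0 \<le> B\<close>] by (metis UNIV_I real_norm_def)
      have [measurable]: "G \<in> borel_measurable borel" using G(1) by (rule borel_measurable_continuous_onI)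
      have "(\<lambda>k. integral\<^sup>L (M (r k)) (\<lambda>x. G (s x))) \<longlonglongrightarrow> integral\<^sup>L L G"
        by (rule convI[OF G(1) G(3)])
      moreover have "G (s x) = h x" for x by (simp add: G(2)[OF E(3)] fs)
      moreover have "integral\<^sup>L L G = integral\<^sup>L (distr L borel f) h"
      proof -
        have "integral\<^sup>L L G = (\<integral>y. h (f y) \<partial>L)"
          by (rule integral_cong_AE) (use AE_E in \<open>auto elim!: eventually_mono simp: G(2)\<close>)
        then show ?thesis by (simp add: integral_distr)
      qed
      ultimately show "(\<lambda>k. integral\<^sup>L ((M \<circ> r) k) h) \<longlonglongrightarrow> integral\<^sup>L (distr L borel f) h" by simp
    qed
  qed
qed

text \<open>The integrand may be unbounded, so it is truncated at \<open>n\<close> for the limit in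
  \<open>k\<close> and released by monotone convergence. The bounds \<open>c k\<close> vary because
  the couplings used later meet their bound only up to a vanishing error.\<close>

lemma narrow_limit_nn_integral_le:
  fixes M :: "nat \<Rightarrow> 'a::metric_space measure" and h :: "'a \<Rightarrow> real"
  assumes pM: "\<And>k. prob_space (M k)" and sM: "\<And>k. sets (M k) = sets borel"
    and pM': "prob_space M'" and sM': "sets M' = sets borel"
    and conv: "narrowly_converges M M'"
    and h: "continuous_on UNIV h" "\<And>x. 0 \<le> h x"
    and le: "\<And>k. (\<integral>\<^sup>+ x. ennreal (h x) \<partial>M k) \<le> ennreal (c k)"
    and c: "c \<longlonglongrightarrow> l" "\<And>k. 0 \<le> c k"
  shows "(\<integral>\<^sup>+ x. ennreal (h x) \<partial>M') \<le> ennreal l"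
proof -
  have [measurable]: "h \<in> borel_measurable borel" using h(1) by (rule borel_measurable_continuous_onI)
  have eq: "(\<integral>\<^sup>+ x. ennreal (min (h x) (real n)) \<partial>L) = ennreal (\<integral>x. min (h x) (real n) \<partial>L)"
    if "prob_space L" and sL: "sets L = sets borel" for L :: "'a measure" and n
  proof -
    interpret prob_space L by fact
    note [measurable_cong] = sL
    have "integrable L (\<lambda>x. min (h x) (real n))"
      by (rule integrable_const_bound[of _ "real n"]) (auto simp: h(2))
    then show ?thesis by (rule nn_integral_eq_integral) (simp add: h(2))
  qed
  have n: "(\<integral>\<^sup>+ x. ennreal (min (h x) (real n)) \<partial>M') \<le> ennreal l" for n
  proof -
    have "(\<lambda>k. \<integral>x. min (h x) (real n) \<partial>M k) \<longlonglongrightarrow> (\<integral>x. min (h x) (real n) \<partial>M')"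
      by (rule narrowly_convergesD[OF conv])
        (auto intro!: continuous_intros h(1) boundedI[of _ "real n"] simp: h(2))
    moreover have "(\<integral>x. min (h x) (real n) \<partial>M k) \<le> c k" for k
    proof -
      have "ennreal (\<integral>x. min (h x) (real n) \<partial>M k) \<le> (\<integral>\<^sup>+ x. ennreal (h x) \<partial>M k)"
        unfolding eq[OF pM sM, symmetric] by (intro nn_integral_mono ennreal_leI) simp
      also note le[of k]
      finally show ?thesis using c(2)[of k] by simp
    qed
    ultimately have "(\<integral>x. min (h x) (real n) \<partial>M') \<le> l"
      using c(1) by (intro LIMSEQ_le) auto
    then show ?thesis unfolding eq[OF pM' sM'] by (rule ennreal_leI)
  qed
  note [measurable_cong] = sM'
  have "(\<integral>\<^sup>+ x. ennreal (h x) \<partial>M') = (\<integral>\<^sup>+ x. (SUP n. ennreal (min (h x) (real n))) \<partial>M')"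
  proof (rule nn_integral_cong)
    fix x
    obtain n where "h x \<le> real n" using real_arch_simple by blast
    then have "ennreal (h x) \<le> (SUP n. ennreal (min (h x) (real n)))"
      by (intro SUP_upper2[of n]) auto
    moreover have "(SUP n. ennreal (min (h x) (real n))) \<le> ennreal (h x)"
      by (intro SUP_least ennreal_leI) simp
    ultimately show "ennreal (h x) = (SUP n. ennreal (min (h x) (real n)))" by (rule antisym)
  qed
  also have "\<dots> = (SUP n. \<integral>\<^sup>+ x. ennreal (min (h x) (real n)) \<partial>M')"
    by (rule nn_integral_monotone_convergence_SUP) (auto simp: incseq_def le_fun_def intro!: ennreal_leI)
  also have "\<dots> \<le> ennreal l" by (intro SUP_least n)
  finally show ?thesis .
qed

text \<open>Near-optimal couplings of \<open>\<nu>\<close> and \<open>M k\<close> have bounded first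
  moments, so a subsequence converges narrowly; its limit has the right marginals, and its cost
  respects the bound. A constant bound \<open>c\<close> in place of a lower limit suffices for the
  contradiction in \<open>Med_nonempty\<close>.\<close>

lemma transport_cost_lower_semicontinuous:
  fixes \<nu> :: "'a::metric_space measure" and M :: "nat \<Rightarrow> 'a measure" and x0 :: 'a
  assumes proper: "\<forall>(x::'a) r. compact (cball x r)"
    and p\<nu>: "prob_space \<nu>" and s\<nu>: "sets \<nu> = sets borel"
    and pM: "\<And>k. prob_space (M k)" and sM: "\<And>k. sets (M k) = sets borel"
    and pm: "prob_space m" and sm: "sets m = sets borel"
    and m\<nu>: "(\<integral>\<^sup>+ x. ennreal (dist x0 x) \<partial>\<nu>) < \<infinity>"
    and mM: "\<And>k. (\<integral>\<^sup>+ x. ennreal (dist x0 x) \<partial>M k) \<le> ennreal C" and C: "0 \<le> C"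
    and conv: "narrowly_converges M m"
    and le: "\<And>k. transport_cost \<nu> (M k) \<le> ennreal c" and c: "0 \<le> c"
  shows "transport_cost \<nu> m \<le> ennreal c"
proof -
  obtain q :: "nat \<Rightarrow> 'a" where q: "\<And>x e. e > 0 \<Longrightarrow> \<exists>n. dist x (q n) < e"
    using proper_dense_sequence[OF proper] by blast
  note bp = sets_borel_pair_dense[OF q q]
  have "\<exists>\<gamma>\<in>couplings \<nu> (M k). (\<integral>\<^sup>+ p. ennreal (dist (fst p) (snd p)) \<partial>\<gamma>) < ennreal (c + inverse (real (Suc k)))" for k
  proof -
    have "transport_cost \<nu> (M k) < ennreal (c + inverse (real (Suc k)))"
      using le[of k] c by (elim le_less_trans) (auto intro!: ennreal_lessI add_nonneg_pos)
    then show ?thesis unfolding transport_cost_def by (subst (asm) INF_less_iff)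
  qed
  then obtain \<gamma> where g: "\<And>k. \<gamma> k \<in> couplings \<nu> (M k)"
    and gc: "\<And>k. (\<integral>\<^sup>+ p. ennreal (dist (fst p) (snd p)) \<partial>\<gamma> k) < ennreal (c + inverse (real (Suc k)))"
    by metis
  have pg: "prob_space (\<gamma> k)" for k by (rule prob_space_coupling[OF g p\<nu>])
  have sg: "sets (\<gamma> k) = sets borel" for k using g[of k] bp by (simp add: couplings_def)
  have [measurable]: "dist x0 \<in> borel_measurable borel"
    by (intro borel_measurable_continuous_onI continuous_intros)
  define A where "A = enn2real (\<integral>\<^sup>+ x. ennreal (dist x0 x) \<partial>\<nu>)"
  have A: "(\<integral>\<^sup>+ x. ennreal (dist x0 x) \<partial>\<nu>) = ennreal A" "0 \<le> A"
    using m\<nu> unfolding A_def by (simp_all add: less_top)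
  \<comment> \<open>The Euclidean product distance is at most the sum of the two distances, so the
    moments of the marginals give a bound uniform in \<open>k\<close>.\<close>
  have mg: "(\<integral>\<^sup>+ p. ennreal (dist (x0, x0) p) \<partial>\<gamma> k) \<le> ennreal (A + C)" for k
  proof -
    have [measurable_cong]: "sets (\<gamma> k) = sets (borel \<Otimes>\<^sub>M borel)" using g[of k] by (simp add: couplings_def)
    have "(\<integral>\<^sup>+ p. ennreal (dist (x0, x0) p) \<partial>\<gamma> k)
        \<le> (\<integral>\<^sup>+ p. ennreal (dist x0 (fst p)) + ennreal (dist x0 (snd p)) \<partial>\<gamma> k)"
      by (intro nn_integral_mono)
        (auto simp: dist_prod_def ennreal_plus[symmetric] sqrt_sum_squares_le_sum intro!: ennreal_leI simp del: ennreal_plus)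
    also have "\<dots> = (\<integral>\<^sup>+ p. ennreal (dist x0 (fst p)) \<partial>\<gamma> k) + (\<integral>\<^sup>+ p. ennreal (dist x0 (snd p)) \<partial>\<gamma> k)"
      by (rule nn_integral_add) measurable
    also have "\<dots> = ennreal A + (\<integral>\<^sup>+ x. ennreal (dist x0 x) \<partial>M k)"
      using couplings_nn_integral[OF g[of k], of "\<lambda>x. ennreal (dist x0 x)"] A by simp
    also have "\<dots> \<le> ennreal A + ennreal C" by (intro add_left_mono mM)
    finally show ?thesis using A C by simp
  qed
  obtain r \<gamma>' where r: "strict_mono (r :: nat \<Rightarrow> nat)" and pg': "prob_space \<gamma>'" and sg': "sets \<gamma>' = sets borel"
    and gconv: "narrowly_converges (\<gamma> \<circ> r) \<gamma>'"
    using bounded_moment_narrow_subsequence[of \<gamma> "(x0, x0)" "A + C", OF compact_cball_prod[OF proper proper] pg sg mg]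
      A C by auto
  interpret g': prob_space \<gamma>' by (rule pg')
  have sg2 [measurable_cong]: "sets \<gamma>' = sets (borel \<Otimes>\<^sub>M borel)" using sg' bp by simp
  have "distr \<gamma>' borel fst = \<nu>"
  proof (rule measure_eqI_bounded_continuous)
    show "finite_measure (distr \<gamma>' borel fst)" by (rule g'.finite_measure_distr) measurable
    show "finite_measure \<nu>" using p\<nu> by (rule prob_space.finite_measure)
    fix f :: "'a \<Rightarrow> real" assume f: "continuous_on UNIV f" "bounded (range f)"
    have [measurable]: "f \<in> borel_measurable borel" using f(1) by (rule borel_measurable_continuous_onI)
    have "(\<lambda>k. integral\<^sup>L ((\<gamma> \<circ> r) k) (\<lambda>p. f (fst p))) \<longlonglongrightarrow> integral\<^sup>L \<gamma>' (\<lambda>p. f (fst p))"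
      by (rule narrowly_convergesD[OF gconv])
        (auto intro!: continuous_on_compose2[OF f(1)] continuous_intros intro: bounded_subset[OF f(2)])
    moreover have "integral\<^sup>L (\<gamma> k) (\<lambda>p. f (fst p)) = integral\<^sup>L \<nu> f" for k
    proof -
      have [measurable_cong]: "sets (\<gamma> k) = sets (borel \<Otimes>\<^sub>M borel)" and e: "distr (\<gamma> k) borel fst = \<nu>"
        using g[of k] by (auto simp: couplings_def)
      show ?thesis unfolding e[symmetric] by (simp add: integral_distr)
    qed
    ultimately have "integral\<^sup>L \<gamma>' (\<lambda>p. f (fst p)) = integral\<^sup>L \<nu> f" by (simp add: LIMSEQ_const_iff)
    then show "integral\<^sup>L (distr \<gamma>' borel fst) f = integral\<^sup>L \<nu> f" by (simp add: integral_distr)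
  qed (simp_all add: s\<nu>)
  moreover have "distr \<gamma>' borel snd = m"
  proof (rule measure_eqI_bounded_continuous)
    show "finite_measure (distr \<gamma>' borel snd)" by (rule g'.finite_measure_distr) measurable
    show "finite_measure m" using pm by (rule prob_space.finite_measure)
    fix f :: "'a \<Rightarrow> real" assume f: "continuous_on UNIV f" "bounded (range f)"
    have [measurable]: "f \<in> borel_measurable borel" using f(1) by (rule borel_measurable_continuous_onI)
    have "(\<lambda>k. integral\<^sup>L ((\<gamma> \<circ> r) k) (\<lambda>p. f (snd p))) \<longlonglongrightarrow> integral\<^sup>L \<gamma>' (\<lambda>p. f (snd p))"
      by (rule narrowly_convergesD[OF gconv])
        (auto intro!: continuous_on_compose2[OF f(1)] continuous_intros intro: bounded_subset[OF f(2)])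
    moreover have "integral\<^sup>L (\<gamma> k) (\<lambda>p. f (snd p)) = integral\<^sup>L (M k) f" for k
    proof -
      have [measurable_cong]: "sets (\<gamma> k) = sets (borel \<Otimes>\<^sub>M borel)" and e: "distr (\<gamma> k) borel snd = M k"
        using g[of k] by (auto simp: couplings_def)
      show ?thesis unfolding e[symmetric] by (simp add: integral_distr)
    qed
    moreover have "(\<lambda>k. integral\<^sup>L (M (r k)) f) \<longlonglongrightarrow> integral\<^sup>L m f"
      using LIMSEQ_subseq_LIMSEQ[OF narrowly_convergesD[OF conv f] r] by (simp add: comp_def)
    ultimately have "integral\<^sup>L \<gamma>' (\<lambda>p. f (snd p)) = integral\<^sup>L m f" by (simp add: LIMSEQ_unique)
    then show "integral\<^sup>L (distr \<gamma>' borel snd) f = integral\<^sup>L m f" by (simp add: integral_distr)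
  qed (simp_all add: sm)
  ultimately have "\<gamma>' \<in> couplings \<nu> m" unfolding couplings_def using sg2 by simp
  then have "transport_cost \<nu> m \<le> (\<integral>\<^sup>+ p. ennreal (dist (fst p) (snd p)) \<partial>\<gamma>')"
    unfolding transport_cost_def by (rule INF_lower)
  also have "\<dots> \<le> ennreal c"
  proof (rule narrow_limit_nn_integral_le[OF _ _ pg' sg' gconv])
    show "continuous_on UNIV (\<lambda>p :: 'a \<times> 'a. dist (fst p) (snd p))" by (intro continuous_intros)
    show "(\<integral>\<^sup>+ p. ennreal (dist (fst p) (snd p)) \<partial>(\<gamma> \<circ> r) k) \<le> ennreal (c + inverse (real (Suc (r k))))" for k
      using gc[of "r k"] by simp
    have "(\<lambda>k. c + inverse (real (Suc k))) \<longlonglongrightarrow> c + 0"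
      by (intro tendsto_intros LIMSEQ_inverse_real_of_nat)
    then show "(\<lambda>k. c + inverse (real (Suc (r k)))) \<longlonglongrightarrow> c"
      using LIMSEQ_subseq_LIMSEQ[OF _ r] by (simp add: comp_def)
    show "0 \<le> c + inverse (real (Suc (r k)))" for k using c by simp
  qed (simp_all add: pg sg)
  finally show ?thesis .
qed

subsection \<open>Wasserstein medians and their break-down point\<close>

text \<open>The definition of \<open>P1\<close> supplies only some base point; the triangle
  inequality carries finiteness to any other.\<close>

lemma P1D:
  assumes "\<mu> \<in> P1"
  shows "prob_space \<mu>" "sets \<mu> = sets borel" "(\<integral>\<^sup>+ x. ennreal (dist x0 x) \<partial>\<mu>) < \<infinity>"
proof -
  show p: "prob_space \<mu>" and s: "sets \<mu> = sets borel" using assms by (auto simp: P1_def)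
  interpret prob_space \<mu> by fact
  note [measurable_cong] = s
  obtain y where y: "(\<integral>\<^sup>+ x. ennreal (dist y x) \<partial>\<mu>) < \<infinity>" using assms by (auto simp: P1_def)
  have [measurable]: "dist z \<in> borel_measurable borel" for z :: 'a
    by (intro borel_measurable_continuous_onI continuous_intros)
  have "(\<integral>\<^sup>+ x. ennreal (dist x0 x) \<partial>\<mu>) \<le> (\<integral>\<^sup>+ x. ennreal (dist x0 y) + ennreal (dist y x) \<partial>\<mu>)"
    by (intro nn_integral_mono)
      (simp add: ennreal_plus[symmetric] dist_triangle ennreal_leI del: ennreal_plus)
  also have "\<dots> = ennreal (dist x0 y) + (\<integral>\<^sup>+ x. ennreal (dist y x) \<partial>\<mu>)"
    by (subst nn_integral_add) (simp_all add: emeasure_space_1)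
  also have "\<dots> < \<infinity>" using y by simp
  finally show "(\<integral>\<^sup>+ x. ennreal (dist x0 x) \<partial>\<mu>) < \<infinity>" .
qed

lemma return_in_P1: "return borel x \<in> P1"
proof -
  have "prob_space (return borel x)" by (rule prob_space_return) simp
  moreover have "(\<integral>\<^sup>+ y. ennreal (dist x y) \<partial>return borel x) = 0"
    by (subst nn_integral_return) (auto intro!: borel_measurable_continuous_onI continuous_intros)
  ultimately show ?thesis unfolding P1_def by (auto intro!: exI[of _ x])
qed

lemma W1_nonneg: "0 \<le> W1 \<mu> \<nu>"
  by (simp add: W1_eq)

lemma W1_self:
  fixes \<mu> :: "'a::metric_space measure"
  assumes proper: "\<forall>(x::'a) r. compact (cball x r)" and s: "sets \<mu> = sets borel"
  shows "W1 \<mu> \<mu> = 0"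
proof -
  note [measurable_cong] = s
  obtain q :: "nat \<Rightarrow> 'a" where q: "\<And>x e. e > 0 \<Longrightarrow> \<exists>n. dist x (q n) < e"
    using proper_dense_sequence[OF proper] by blast
  note [measurable] = measurable_dist_dense[OF q]
  let ?g = "distr \<mu> (borel \<Otimes>\<^sub>M borel) (\<lambda>x. (x, x))"
  have "distr \<mu> borel (\<lambda>x. x) = \<mu>" by (rule distr_id2) (simp add: s)
  then have "?g \<in> couplings \<mu> \<mu>" unfolding couplings_def by (simp add: distr_distr comp_def)
  then have "transport_cost \<mu> \<mu> \<le> (\<integral>\<^sup>+ p. ennreal (dist (fst p) (snd p)) \<partial>?g)"
    unfolding transport_cost_def by (rule INF_lower)
  also have "\<dots> = 0" by (subst nn_integral_distr) simp_all
  finally show ?thesis by (simp add: W1_eq)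
qed

text \<open>The independent coupling costs at most the sum of the two first moments.\<close>

lemma transport_cost_finite:
  fixes \<mu> \<nu> :: "'a::metric_space measure"
  assumes \<mu>: "\<mu> \<in> P1" and \<nu>: "\<nu> \<in> P1"
  shows "transport_cost \<mu> \<nu> < \<infinity>"
proof -
  define x0 where "x0 = (undefined :: 'a)"
  have [measurable]: "dist x0 \<in> borel_measurable borel"
    by (intro borel_measurable_continuous_onI continuous_intros)
  have g: "\<mu> \<Otimes>\<^sub>M \<nu> \<in> couplings \<mu> \<nu>" using P1D(1,2)[OF \<mu>] P1D(1,2)[OF \<nu>] by (intro couplings_pair)
  then have [measurable_cong]: "sets (\<mu> \<Otimes>\<^sub>M \<nu>) = sets (borel \<Otimes>\<^sub>M borel)" by (simp add: couplings_def)
  have "transport_cost \<mu> \<nu> \<le> (\<integral>\<^sup>+ p. ennreal (dist (fst p) (snd p)) \<partial>(\<mu> \<Otimes>\<^sub>M \<nu>))"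
    unfolding transport_cost_def by (rule INF_lower[OF g])
  also have "\<dots> \<le> (\<integral>\<^sup>+ p. ennreal (dist x0 (fst p)) + ennreal (dist x0 (snd p)) \<partial>(\<mu> \<Otimes>\<^sub>M \<nu>))"
    by (intro nn_integral_mono)
      (simp add: ennreal_plus[symmetric] dist_triangle3 ennreal_leI del: ennreal_plus)
  also have "\<dots> = (\<integral>\<^sup>+ p. ennreal (dist x0 (fst p)) \<partial>(\<mu> \<Otimes>\<^sub>M \<nu>)) + (\<integral>\<^sup>+ p. ennreal (dist x0 (snd p)) \<partial>(\<mu> \<Otimes>\<^sub>M \<nu>))"
    by (rule nn_integral_add) measurable
  also have "\<dots> = (\<integral>\<^sup>+ x. ennreal (dist x0 x) \<partial>\<mu>) + (\<integral>\<^sup>+ x. ennreal (dist x0 x) \<partial>\<nu>)"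
    using couplings_nn_integral[OF g, of "\<lambda>x. ennreal (dist x0 x)"] by simp
  also have "\<dots> < \<infinity>" using P1D(3)[OF \<mu>] P1D(3)[OF \<nu>] by simp
  finally show ?thesis .
qed

lemma transport_cost_eq_W1:
  assumes "\<mu> \<in> P1" "\<nu> \<in> P1"
  shows "transport_cost \<mu> \<nu> = ennreal (W1 \<mu> \<nu>)"
  using transport_cost_finite[OF assms] by (simp add: W1_eq less_top)

lemma W1_commute:
  fixes \<mu> \<nu> :: "'a::metric_space measure"
  assumes proper: "\<forall>(x::'a) r. compact (cball x r)"
  shows "W1 \<mu> \<nu> = W1 \<nu> \<mu>"
proof -
  obtain q :: "nat \<Rightarrow> 'a" where q: "\<And>x e. e > 0 \<Longrightarrow> \<exists>n. dist x (q n) < e"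
    using proper_dense_sequence[OF proper] by blast
  show ?thesis unfolding W1_eq by (rule arg_cong[OF transport_cost_commute[OF q]])
qed

lemma W1_triangle:
  fixes \<mu> m \<nu> :: "'a::metric_space measure"
  assumes proper: "\<forall>(x::'a) r. compact (cball x r)" and P: "\<mu> \<in> P1" "m \<in> P1" "\<nu> \<in> P1"
  shows "W1 \<mu> \<nu> \<le> W1 \<mu> m + W1 m \<nu>"
proof -
  obtain q :: "nat \<Rightarrow> 'a" where q: "\<And>x e. e > 0 \<Longrightarrow> \<exists>n. dist x (q n) < e"
    using proper_dense_sequence[OF proper] by blast
  have "ennreal (W1 \<mu> \<nu>) \<le> ennreal (W1 \<mu> m + W1 m \<nu>)"
    using transport_cost_triangle[OF q P1D(1)[OF P(2)], of \<mu> \<nu>] P by (simp add: transport_cost_eq_W1 W1_nonneg)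
  then show ?thesis by (simp add: W1_nonneg ennreal_plus[symmetric] del: ennreal_plus)
qed

text \<open>The function \<open>dist x0\<close> is 1-Lipschitz. This gives moment bounds along
  minimizing sequences and, for a Dirac mass, a lower bound on \<open>W1\<close>.\<close>

lemma moment_le_W1:
  fixes \<mu> \<nu> :: "'a::metric_space measure"
  assumes proper: "\<forall>(x::'a) r. compact (cball x r)" and P: "\<mu> \<in> P1" "\<nu> \<in> P1"
  shows "(\<integral>\<^sup>+ x. ennreal (dist x0 x) \<partial>\<nu>) \<le> (\<integral>\<^sup>+ x. ennreal (dist x0 x) \<partial>\<mu>) + ennreal (W1 \<mu> \<nu>)"
proof -
  obtain q :: "nat \<Rightarrow> 'a" where q: "\<And>x e. e > 0 \<Longrightarrow> \<exists>n. dist x (q n) < e"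
    using proper_dense_sequence[OF proper] by blast
  note [measurable] = measurable_dist_dense[OF q]
  have [measurable]: "dist x0 \<in> borel_measurable borel"
    by (intro borel_measurable_continuous_onI continuous_intros)
  let ?m = "\<lambda>\<mu>. \<integral>\<^sup>+ x. ennreal (dist x0 x) \<partial>\<mu>"
  have fin: "?m \<mu> < \<infinity>" by (rule P1D(3)[OF P(1)])
  \<comment> \<open>With both moments on the left, the bound holds coupling by coupling and passes
    to the infimum.\<close>
  have "?m \<nu> - ?m \<mu> \<le> transport_cost \<mu> \<nu>"
    unfolding transport_cost_def
  proof (rule INF_greatest)
    fix \<gamma> assume g: "\<gamma> \<in> couplings \<mu> \<nu>"
    then have [measurable_cong]: "sets \<gamma> = sets (borel \<Otimes>\<^sub>M borel)" by (simp add: couplings_def)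
    have "?m \<nu> = (\<integral>\<^sup>+ p. ennreal (dist x0 (snd p)) \<partial>\<gamma>)"
      using couplings_nn_integral(2)[OF g, of "\<lambda>x. ennreal (dist x0 x)"] by simp
    also have "\<dots> \<le> (\<integral>\<^sup>+ p. ennreal (dist x0 (fst p)) + ennreal (dist (fst p) (snd p)) \<partial>\<gamma>)"
      by (intro nn_integral_mono)
        (simp add: ennreal_plus[symmetric] dist_triangle ennreal_leI del: ennreal_plus)
    also have "\<dots> = (\<integral>\<^sup>+ p. ennreal (dist x0 (fst p)) \<partial>\<gamma>) + (\<integral>\<^sup>+ p. ennreal (dist (fst p) (snd p)) \<partial>\<gamma>)"
      by (rule nn_integral_add) measurable
    also have "(\<integral>\<^sup>+ p. ennreal (dist x0 (fst p)) \<partial>\<gamma>) = ?m \<mu>"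
      using couplings_nn_integral(1)[OF g, of "\<lambda>x. ennreal (dist x0 x)"] by simp
    finally show "?m \<nu> - ?m \<mu> \<le> (\<integral>\<^sup>+ p. ennreal (dist (fst p) (snd p)) \<partial>\<gamma>)"
      using fin by (auto simp: ennreal_minus_le_iff add.commute)
  qed
  then show ?thesis
    using fin P by (simp add: ennreal_minus_le_iff transport_cost_eq_W1 add.commute)
qed

section \<open>Existence of medians\<close>

lemma Med_nonempty:
  fixes \<nu> :: "nat \<Rightarrow> 'a::metric_space measure"
  assumes proper: "\<forall>(x::'a) r. compact (cball x r)"
    and nu: "\<And>i. i < N \<Longrightarrow> \<nu> i \<in> P1"
    and lam0: "\<And>i. i < N \<Longrightarrow> lam i \<ge> 0"
    and lam1: "(\<Sum>i<N. lam i) = (1::real)"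
  shows "Med N lam \<nu> \<noteq> {}"
proof -
  define x0 where "x0 = (undefined :: 'a)"
  define F where "F m = (\<Sum>i<N. lam i * W1 (\<nu> i) m)" for m
  have F0: "0 \<le> F m" for m unfolding F_def by (intro sum_nonneg mult_nonneg_nonneg lam0 W1_nonneg) auto
  define a where "a = Inf (F ` P1)"
  have bdd: "bdd_below (F ` P1)" using F0 by (intro bdd_belowI[of _ 0]) auto
  have "\<exists>m\<in>P1. F m < a + inverse (real (Suc k))" for k
  proof -
    have "\<exists>z\<in>F ` P1. z < a + inverse (real (Suc k))"
      unfolding a_def by (rule cInf_lessD) (use return_in_P1 in auto)
    then show ?thesis by blast
  qed
  then obtain M where M: "\<And>k. M k \<in> P1" "\<And>k. F (M k) < a + inverse (real (Suc k))" by metis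
  \<comment> \<open>Weights may vanish; one positive weight turns a bound on the objective into a
    bound on the distance to \<open>\<nu> i0\<close>, hence on first moments.\<close>
  have "\<exists>i<N. 0 < lam i"
  proof (rule ccontr)
    assume "\<not> (\<exists>i<N. 0 < lam i)"
    then have "lam i \<le> 0" if "i < N" for i using that by (meson not_less)
    then have "(\<Sum>i<N. lam i) \<le> 0" by (intro sum_nonpos) simp
    then show False using lam1 by simp
  qed
  then obtain i0 where i0: "i0 < N" "0 < lam i0" by blast
  have "W1 (\<nu> i0) (M k) \<le> (a + 1) / lam i0" for k
  proof -
    have "lam i0 * W1 (\<nu> i0) (M k) \<le> F (M k)"
      unfolding F_def using i0 by (intro member_le_sum) (auto intro!: mult_nonneg_nonneg lam0 W1_nonneg)
    also have "\<dots> \<le> a + inverse (real (Suc k))" using M(2)[of k] by simp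
    also have "\<dots> \<le> a + 1" by (simp add: field_simps)
    finally show ?thesis using i0(2) by (simp add: field_simps)
  qed
  note WM = this
  define C where "C = enn2real (\<integral>\<^sup>+ x. ennreal (dist x0 x) \<partial>\<nu> i0) + (a + 1) / lam i0"
  have a1: "0 \<le> (a + 1) / lam i0" using WM[of 0] W1_nonneg[of "\<nu> i0" "M 0"] by linarith
  have C: "0 \<le> C" unfolding C_def using a1 by simp
  have mom: "(\<integral>\<^sup>+ x. ennreal (dist x0 x) \<partial>M k) \<le> ennreal C" for k
  proof -
    have "(\<integral>\<^sup>+ x. ennreal (dist x0 x) \<partial>M k) \<le> (\<integral>\<^sup>+ x. ennreal (dist x0 x) \<partial>\<nu> i0) + ennreal (W1 (\<nu> i0) (M k))"
      by (rule moment_le_W1[OF proper nu[OF i0(1)] M(1)])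
    also have "\<dots> \<le> (\<integral>\<^sup>+ x. ennreal (dist x0 x) \<partial>\<nu> i0) + ennreal ((a + 1) / lam i0)"
      by (intro add_left_mono ennreal_leI WM)
    also have "\<dots> = ennreal C"
      unfolding C_def using P1D(3)[OF nu[OF i0(1)], of x0] a1 by (simp add: less_top)
    finally show ?thesis .
  qed
  obtain r m where r: "strict_mono (r :: nat \<Rightarrow> nat)" and m: "prob_space m" "sets m = sets borel"
    and conv: "narrowly_converges (M \<circ> r) m"
    using bounded_moment_narrow_subsequence[of M x0 C, OF proper P1D(1)[OF M(1)] P1D(2)[OF M(1)] mom C] by blast
  have "(\<integral>\<^sup>+ x. ennreal (dist x0 x) \<partial>m) \<le> ennreal C"
    by (rule narrow_limit_nn_integral_le[OF _ _ m conv, where c="\<lambda>_. C"])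
      (auto intro!: continuous_intros simp: P1D(1,2)[OF M(1)] mom C)
  then have "(\<integral>\<^sup>+ x. ennreal (dist x0 x) \<partial>m) < \<infinity>" by (rule le_less_trans) simp
  then have mP: "m \<in> P1" using m unfolding P1_def by blast
  \<comment> \<open>Otherwise some subsequence stays below \<open>W1 (\<nu> i) m - e\<close>, and
    lower semicontinuity bounds \<open>W1 (\<nu> i) m\<close> by that same value.\<close>
  have lsc: "\<forall>\<^sub>F k in sequentially. W1 (\<nu> i) m - e \<le> W1 (\<nu> i) (M (r k))" if i: "i < N" and e: "e > 0" for i e
  proof (rule ccontr)
    assume "\<not> ?thesis"
    then obtain u where u: "strict_mono (u :: nat \<Rightarrow> nat)" "\<And>k. W1 (\<nu> i) (M (r (u k))) < W1 (\<nu> i) m - e"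
      using not_eventually_sequentiallyD by (metis not_le)
    define c where "c = W1 (\<nu> i) m - e"
    have c: "0 \<le> c" using u(2)[of 0] W1_nonneg[of "\<nu> i" "M (r (u 0))"] unfolding c_def by linarith
    have "narrowly_converges (M \<circ> r \<circ> u) m"
      unfolding narrowly_converges_def
    proof (intro allI impI)
      fix f :: "'a \<Rightarrow> real" assume f: "continuous_on UNIV f" "bounded (range f)"
      show "(\<lambda>k. integral\<^sup>L ((M \<circ> r \<circ> u) k) f) \<longlonglongrightarrow> integral\<^sup>L m f"
        using LIMSEQ_subseq_LIMSEQ[OF narrowly_convergesD[OF conv f] u(1)] by (simp add: comp_def)
    qed
    moreover have "transport_cost (\<nu> i) ((M \<circ> r \<circ> u) k) \<le> ennreal c" for k
      using u(2)[of k] by (simp add: transport_cost_eq_W1[OF nu[OF i] M(1)] c_def ennreal_leI)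
    moreover have "prob_space ((M \<circ> r \<circ> u) k)" "sets ((M \<circ> r \<circ> u) k) = sets borel"
      "(\<integral>\<^sup>+ x. ennreal (dist x0 x) \<partial>(M \<circ> r \<circ> u) k) \<le> ennreal C" for k
      using P1D(1,2)[OF M(1)] mom by simp_all
    ultimately have "transport_cost (\<nu> i) m \<le> ennreal c"
      by (intro transport_cost_lower_semicontinuous[OF proper P1D(1,2)[OF nu[OF i]] _ _ m
        P1D(3)[OF nu[OF i], of x0] _ C _ _ c])
    then have "W1 (\<nu> i) m \<le> c" using c by (simp add: transport_cost_eq_W1[OF nu[OF i] mP])
    then show False using e unfolding c_def by simp
  qed
  \<comment> \<open>Half of \<open>e\<close> is lost to semicontinuity, without a factor
    \<open>N\<close> since the weights sum to 1, and half to the minimizing sequence.\<close>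
  have "F m \<le> a"
  proof (rule field_le_epsilon)
    fix e :: real assume e: "e > 0"
    then have e2: "e / 2 > 0" by simp
    have "\<forall>\<^sub>F k in sequentially. \<forall>i\<in>{..<N}. W1 (\<nu> i) m - e / 2 \<le> W1 (\<nu> i) (M (r k))"
      by (rule eventually_ball_finite) (auto intro: lsc e2)
    moreover have "(\<lambda>k. inverse (real (Suc (r k)))) \<longlonglongrightarrow> 0"
      using LIMSEQ_subseq_LIMSEQ[OF LIMSEQ_inverse_real_of_nat r] by (simp add: comp_def)
    then have "\<forall>\<^sub>F k in sequentially. inverse (real (Suc (r k))) < e / 2"
      using e2 by (rule order_tendstoD)
    ultimately have "\<forall>\<^sub>F k in sequentially. F m \<le> a + e"
    proof eventually_elim
      case (elim k)
      have "F m - e / 2 = (\<Sum>i<N. lam i * (W1 (\<nu> i) m - e / 2))"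
        unfolding F_def by (simp add: right_diff_distrib sum_subtractf sum_distrib_right[symmetric] lam1 flip: sum_divide_distrib)
      also have "\<dots> \<le> F (M (r k))"
        unfolding F_def using elim(1) by (intro sum_mono mult_left_mono lam0) auto
      also have "\<dots> \<le> a + e / 2" using M(2)[of "r k"] elim(2) by linarith
      finally show ?case by simp
    qed
    then show "F m \<le> a + e" by simp
  qed
  then have "F m \<le> F m'" if "m' \<in> P1" for m'
    using cInf_lower[OF imageI[OF that] bdd] unfolding a_def by linarith
  then have "m \<in> Med N lam \<nu>" unfolding Med_def F_def using mP by blast
  then show ?thesis by blast
qed

section \<open>Corrupting a majority and corrupting a minority\<close>

text \<open>Moving from \<open>m\<close> to \<open>m'\<close> costs \<open>W1 m m'\<close> at each
  corrupted index and gains at most that much at any other. With at least half of the weight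
  corrupted no move pays; a tie at exactly 1/2 is harmless because medians are defined by a
  non-strict inequality.\<close>

lemma corrupted_majority_in_Med:
  fixes \<nu> :: "nat \<Rightarrow> 'a::metric_space measure"
  assumes proper: "\<forall>(x::'a) r. compact (cball x r)"
    and nu: "\<And>i. i < N \<Longrightarrow> \<nu> i \<in> P1"
    and lam0: "\<And>i. i < N \<Longrightarrow> lam i \<ge> 0"
    and lam1: "(\<Sum>i<N. lam i) = (1::real)"
    and I: "I \<subseteq> {..<N}" "1 / 2 \<le> sum lam I" and m: "m \<in> P1"
  shows "m \<in> Med N lam (\<lambda>j. if j \<in> I then m else \<nu> j)"
proof -
  let ?y = "\<lambda>j. if j \<in> I then m else \<nu> j"
  have split: "(\<Sum>i<N. g i) = sum g I + sum g ({..<N} - I)" for g :: "nat \<Rightarrow> real"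
    using sum.subset_diff[OF I(1), of g] by simp
  have "(\<Sum>i<N. lam i * W1 (?y i) m) \<le> (\<Sum>i<N. lam i * W1 (?y i) m')" if m': "m' \<in> P1" for m'
  proof -
    define D where "D = W1 m m'"
    have D: "0 \<le> D" unfolding D_def by (rule W1_nonneg)
    have I': "sum lam ({..<N} - I) \<le> sum lam I" using split[of lam] lam1 I(2) by simp
    have "(\<Sum>i<N. lam i * W1 (?y i) m) = (\<Sum>i\<in>{..<N} - I. lam i * W1 (\<nu> i) m)"
      unfolding split by (simp add: W1_self[OF proper P1D(2)[OF m]])
    also have "\<dots> \<le> (\<Sum>i\<in>{..<N} - I. lam i * W1 (\<nu> i) m' + lam i * D)"
    proof (rule sum_mono)
      fix i assume i: "i \<in> {..<N} - I"
      have "W1 (\<nu> i) m \<le> W1 (\<nu> i) m' + D"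
        unfolding D_def W1_commute[OF proper, of m m'] using i by (intro W1_triangle proper nu m m') auto
      from mult_left_mono[OF this lam0[of i]] show "lam i * W1 (\<nu> i) m \<le> lam i * W1 (\<nu> i) m' + lam i * D"
        using i by (simp add: distrib_left)
    qed
    also have "\<dots> = (\<Sum>i\<in>{..<N} - I. lam i * W1 (\<nu> i) m') + sum lam ({..<N} - I) * D"
      by (simp add: sum.distrib sum_distrib_right)
    also have "\<dots> \<le> (\<Sum>i\<in>{..<N} - I. lam i * W1 (\<nu> i) m') + sum lam I * D"
      using mult_right_mono[OF I' D] by simp
    also have "\<dots> = (\<Sum>i<N. lam i * W1 (?y i) m')"
      unfolding split D_def by (simp add: sum_distrib_right)
    finally show ?thesis .
  qed
  then show ?thesis unfolding Med_def using m by blast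
qed

text \<open>On the corrupted data, corrupted terms prefer \<open>y\<close> to \<open>z\<close> by at
  most \<open>W1 y z\<close>, while a clean term prefers \<open>z\<close> by at least
  \<open>W1 y z - 2 * W1 (\<nu> i) z\<close>; optimality of \<open>y\<close> balances them. The
  factor 2 arises because \<open>W1 (\<nu> i) z\<close> enters through the triangle inequality and
  again through the objective at \<open>z\<close>.\<close>

lemma corrupted_minority_bound:
  fixes \<nu> :: "nat \<Rightarrow> 'a::metric_space measure"
  assumes proper: "\<forall>(x::'a) r. compact (cball x r)"
    and nu: "\<And>i. i < N \<Longrightarrow> \<nu> i \<in> P1"
    and lam0: "\<And>i. i < N \<Longrightarrow> lam i \<ge> 0"
    and lam1: "(\<Sum>i<N. lam i) = (1::real)"
    and I: "I \<subseteq> {..<N}" and yI: "\<And>j. j \<in> I \<Longrightarrow> yI j \<in> P1" "\<And>j. j \<notin> I \<Longrightarrow> yI j = \<nu> j"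
    and y: "y \<in> Med N lam yI" and z: "z \<in> P1"
  shows "(1 - 2 * sum lam I) * W1 y z \<le> 2 * (\<Sum>i<N. lam i * W1 (\<nu> i) z)"
proof -
  have yP: "y \<in> P1" using y by (simp add: Med_def)
  have split: "(\<Sum>i<N. g i) = sum g I + sum g ({..<N} - I)" for g :: "nat \<Rightarrow> real"
    using sum.subset_diff[OF I, of g] by simp
  define D where "D = W1 y z"
  let ?K = "{..<N} - I"
  have in1: "W1 (yI i) z \<le> W1 (yI i) y + D" if "i \<in> I" for i
    unfolding D_def using that by (intro W1_triangle proper yI yP z)
  have in2: "D - W1 (\<nu> i) z \<le> W1 (\<nu> i) y" if "i \<in> ?K" for i
    using W1_triangle[OF proper yP nu z, of i] that unfolding D_def W1_commute[OF proper, of y "\<nu> i"] by simp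
  have "(\<Sum>i\<in>I. lam i * (W1 (yI i) z - D)) + (\<Sum>i\<in>?K. lam i * (D - W1 (\<nu> i) z))
      \<le> (\<Sum>i\<in>I. lam i * W1 (yI i) y) + (\<Sum>i\<in>?K. lam i * W1 (\<nu> i) y)"
    using I in1 in2 by (intro add_mono sum_mono mult_left_mono lam0) (auto simp: diff_le_eq)
  also have "\<dots> = (\<Sum>i<N. lam i * W1 (yI i) y)" unfolding split by (simp add: yI(2))
  also have "\<dots> \<le> (\<Sum>i<N. lam i * W1 (yI i) z)" using y z by (simp add: Med_def)
  also have "\<dots> = (\<Sum>i\<in>I. lam i * W1 (yI i) z) + (\<Sum>i\<in>?K. lam i * W1 (\<nu> i) z)"
    unfolding split by (simp add: yI(2))
  finally have "(sum lam ?K - sum lam I) * D \<le> 2 * (\<Sum>i\<in>?K. lam i * W1 (\<nu> i) z)"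
    by (simp add: right_diff_distrib left_diff_distrib sum_subtractf sum_distrib_right)
  moreover have "sum lam ?K = 1 - sum lam I" using split[of lam] lam1 by simp
  moreover have "(\<Sum>i\<in>?K. lam i * W1 (\<nu> i) z) \<le> (\<Sum>i<N. lam i * W1 (\<nu> i) z)"
    by (intro sum_mono2) (auto intro!: mult_nonneg_nonneg lam0 W1_nonneg)
  ultimately show ?thesis unfolding D_def by (simp add: algebra_simps)
qed

text \<open>The constant is the first moment of \<open>z\<close> and does not depend on
  \<open>x\<close>, so an unbounded space has Dirac masses arbitrarily far from
  \<open>z\<close>.\<close>

lemma W1_return_ge:
  fixes z :: "'a::metric_space measure"
  assumes proper: "\<forall>(x::'a) r. compact (cball x r)" and z: "z \<in> P1"
  obtains c where "\<And>x. dist x0 x \<le> c + W1 (return borel x) z"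
proof
  fix x
  let ?c = "enn2real (\<integral>\<^sup>+ x. ennreal (dist x0 x) \<partial>z)"
  have "ennreal (dist x0 x) = (\<integral>\<^sup>+ y. ennreal (dist x0 y) \<partial>return borel x)"
    by (subst nn_integral_return) (auto intro!: borel_measurable_continuous_onI continuous_intros)
  also have "\<dots> \<le> (\<integral>\<^sup>+ x. ennreal (dist x0 x) \<partial>z) + ennreal (W1 z (return borel x))"
    by (rule moment_le_W1[OF proper z return_in_P1])
  also have "\<dots> = ennreal (?c + W1 z (return borel x))"
    using P1D(3)[OF z, of x0] by (simp add: W1_nonneg less_top)
  finally show "dist x0 x \<le> ?c + W1 (return borel x) z"
    by (simp add: W1_nonneg W1_commute[OF proper, of "return borel x" z] ennreal_plus[symmetric] del: ennreal_plus)
qed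

text \<open>Both minima range over the same index sets: the distances blow up exactly when the
  corrupted weight is at least 1/2.\<close>

theorem theorem3p4:
  fixes \<nu> :: "nat \<Rightarrow> ('a::metric_space) measure"
    and lam :: "nat \<Rightarrow> real"
    and N :: nat
  assumes proper: "\<forall>(x::'a) r. compact (cball x r)"
    and unbounded: "\<not> bounded (UNIV :: 'a set)"
    and N2: "N \<ge> 2"
    and nu: "\<forall>i<N. \<nu> i \<in> P1"
    and lam_nonneg: "\<forall>i<N. lam i \<ge> 0"
    and lam_sum: "(\<Sum>i<N. lam i) = 1"
  shows "breakdown P1 W1 N lam (Med N lam) \<nu>
           = Min {sum lam J | J. J \<subseteq> {..<N} \<and> sum lam J \<ge> 1/2}"
proof -
  define S where "S I = {W1 y z | y z. \<exists>yI. (\<forall>j\<in>I. yI j \<in> P1) \<and> (\<forall>j. j \<notin> I \<longrightarrow> yI j = \<nu> j)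
                                    \<and> y \<in> Med N lam yI \<and> z \<in> Med N lam \<nu>}" for I
  have nu': "\<And>i. i < N \<Longrightarrow> \<nu> i \<in> P1" and lam0: "\<And>i. i < N \<Longrightarrow> lam i \<ge> 0"
    using nu lam_nonneg by auto
  \<comment> \<open>Keeps the reference set of medians nonempty, so that \<open>S I\<close> can be
    unbounded at all; it also fixes the minimal value \<open>F\<close> below.\<close>
  obtain z0 where z0: "z0 \<in> Med N lam \<nu>" using Med_nonempty[of N \<nu> lam, OF proper nu' lam0 lam_sum] by blast
  have z0P: "z0 \<in> P1" using z0 by (simp add: Med_def)
  have "\<not> bdd_above (S I) \<longleftrightarrow> 1 / 2 \<le> sum lam I" if I: "I \<subseteq> {..<N}" for I
  proof
    assume big: "1 / 2 \<le> sum lam I"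
    show "\<not> bdd_above (S I)"
    proof
      assume "bdd_above (S I)"
      then obtain B where B: "\<And>w. w \<in> S I \<Longrightarrow> w \<le> B" unfolding bdd_above_def by blast
      define x0 where "x0 = (undefined :: 'a)"
      obtain c where c: "\<And>x. dist x0 x \<le> c + W1 (return borel x) z0"
        using W1_return_ge[OF proper z0P] by blast
      have "dist x0 x \<le> c + B" for x
      proof -
        \<comment> \<open>All corrupted entries move to one Dirac mass, which thereby becomes a
          median; a bound on \<open>S I\<close> would then bound the whole space.\<close>
        define yI where "yI j = (if j \<in> I then return borel x else \<nu> j)" for j
        have "return borel x \<in> Med N lam yI"
          unfolding yI_def
          by (rule corrupted_majority_in_Med[of N \<nu> lam, OF proper nu' lam0 lam_sum I big return_in_P1])
        moreover have "\<forall>j\<in>I. yI j \<in> P1" "\<forall>j. j \<notin> I \<longrightarrow> yI j = \<nu> j"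
          by (simp_all add: yI_def return_in_P1)
        ultimately have "W1 (return borel x) z0 \<in> S I" unfolding S_def using z0 by blast
        from B[OF this] show ?thesis using c[of x] by linarith
      qed
      then show False using unbounded unfolding bounded_def by blast
    qed
  next
    assume unb: "\<not> bdd_above (S I)"
    show "1 / 2 \<le> sum lam I"
    proof (rule ccontr)
      assume "\<not> ?thesis"
      then have pos: "0 < 1 - 2 * sum lam I" by simp
      \<comment> \<open>Every median \<open>z\<close> of \<open>\<nu>\<close> has objective at most
        \<open>F\<close>, so the bound is uniform in \<open>z\<close> as well as in \<open>y\<close>
        and \<open>yI\<close>.\<close>
      define F where "F = (\<Sum>i<N. lam i * W1 (\<nu> i) z0)"
      have "w \<le> 2 * F / (1 - 2 * sum lam I)" if "w \<in> S I" for w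
      proof -
        obtain y z yI where w: "w = W1 y z" and yI: "\<And>j. j \<in> I \<Longrightarrow> yI j \<in> P1" "\<And>j. j \<notin> I \<Longrightarrow> yI j = \<nu> j"
          and yz: "y \<in> Med N lam yI" "z \<in> Med N lam \<nu>"
          using \<open>w \<in> S I\<close> unfolding S_def by blast
        have zP: "z \<in> P1" using yz by (simp add: Med_def)
        have "(1 - 2 * sum lam I) * w \<le> 2 * (\<Sum>i<N. lam i * W1 (\<nu> i) z)"
          unfolding w by (rule corrupted_minority_bound[of N \<nu> lam I yI, OF proper nu' lam0 lam_sum I yI yz(1) zP])
        also have "\<dots> \<le> 2 * F" using yz(2) z0P unfolding Med_def F_def by simp
        finally show ?thesis using pos by (simp add: field_simps)
      qed
      then have "bdd_above (S I)" by (rule bdd_aboveI)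
      with unb show False ..
    qed
  qed
  then have "{sum lam I | I. I \<subseteq> {..<N} \<and> \<not> bdd_above (S I)}
      = {sum lam J | J. J \<subseteq> {..<N} \<and> sum lam J \<ge> 1/2}"
    by (intro Collect_cong ex_cong1 conj_cong refl)
  then have "Min {sum lam I | I. I \<subseteq> {..<N} \<and> \<not> bdd_above (S I)}
      = Min {sum lam J | J. J \<subseteq> {..<N} \<and> sum lam J \<ge> 1/2}"
    by (rule arg_cong)
  then show ?thesis unfolding breakdown_def S_def .
qed

end
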